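(* Let $\mathcal{H}_A,\mathcal{H}_B$ have finite dimensions $d_A,d_B$ and $d=\min\{d_A,d_B\}$. For every state $\rho$ on $\mathcal{H}_A\otimes\mathcal{H}_B$, every integer $1\le h\le d^2$ and every $p\in[1,\infty)$, one has $\mathcal{D}^A_{h,p}(\rho)\ge0$. Moreover, for $h\in\{1,2\}$ and every $p\in[1,\infty)$, $\mathcal{D}^A_{h,p}(\rho)=0$ if and only if $\mathcal{D}^A_G(\rho)=0$.
   Context: Let $\{A_i\}$, $\{B_j\}$ be orthonormal bases (w.r.t. the Hilbert–Schmidt inner product $\mathrm{tr}(XY)$) of the real spaces of Hermitian operators on $\mathcal{H}_A$, $\mathcal{H}_B$, and for a state $\sigma$ let $\mathcal{C}(\sigma)_{ij}=\mathrm{tr}(\sigma\,A_i\otimes B_j)$, with singular values $\sigma_1\ge\cdots\ge\sigma_{d^2}$. The Correlation Minor Norm is $\mathcal{M}_{h,p}(\sigma)=\big(\sum_{R\subseteq\{1,\ldots,d^2\},|R|=h}\prod_{k\in R}\sigma_k^p\big)^{1/p}$. A projective measurement $\Pi^A$ on $A$ is given by an orthonormal basis $\{|l\rangle\}_{l=1}^{d_A}$ of $\mathcal{H}_A$, with $\Pi_l=|l\rangle\langle l|$, and acts by $\Pi^A[\rho]=\sum_{l=1}^{d_A}(\Pi_l\otimes\mathbb{1})\rho(\Pi_l\otimes\mathbb{1})$. Define $$\mathcal{D}^A_{h,p}(\rho)=[\mathcal{M}_{h,p}(\rho)]^p-\max_{\Pi^A}[\mathcal{M}_{h,p}(\Pi^A[\rho])]^p,$$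 the maximum over all such projective measurements on $A$. The geometric quantum discord is $\mathcal{D}^A_G(\rho)=\min_{\chi}\|\rho-\chi\|^2$, where $\|\cdot\|$ is the Hilbert–Schmidt (Frobenius) norm and the minimum is over classical-quantum states $\chi=\sum_k p_k|k\rangle\langle k|\otimes\chi_k$, with $\{|k\rangle\}$ an orthonormal basis of $\mathcal{H}_A$, $(p_k)$ a probability vector and $\chi_k$ states on $\mathcal{H}_B$. *)

theory Defs
  imports Complex_Main "Jordan_Normal_Form.Schur_Decomposition"
          "Jordan_Normal_Form.Char_Poly" "HOL-Library.Multiset"
begin

text \<open>Operators on C^n are complex n x n matrices (Jordan_Normal_Form).
  The tensor product H_A (x) H_B is C^(dA*dB) with basis index i*dB + j (Kronecker product).\<close>

definition mtrace :: "complex mat \<Rightarrow> complex" where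
  "mtrace X = (\<Sum>i<dim_row X. X $$ (i,i))"

definition hermitian_mat :: "nat \<Rightarrow> complex mat \<Rightarrow> bool" where
  "hermitian_mat n X \<longleftrightarrow> X \<in> carrier_mat n n \<and> mat_adjoint X = X"

definition psd_mat :: "nat \<Rightarrow> complex mat \<Rightarrow> bool" where
  "psd_mat n X \<longleftrightarrow> hermitian_mat n X \<and>
     (\<forall>v \<in> carrier_vec n. 0 \<le> Re (conjugate v \<bullet> (X *\<^sub>v v)))"

definition density_mat :: "nat \<Rightarrow> complex mat \<Rightarrow> bool" where
  "density_mat n X \<longleftrightarrow> psd_mat n X \<and> mtrace X = 1"

text \<open>Orthonormal basis (w.r.t. tr(XY)) of the real space of Hermitian n x n operators:
  n^2 Hermitian operators, orthonormal (the real dimension of that space is n^2).\<close>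
definition herm_onb :: "nat \<Rightarrow> (nat \<Rightarrow> complex mat) \<Rightarrow> bool" where
  "herm_onb n A \<longleftrightarrow> (\<forall>i < n^2. hermitian_mat n (A i)) \<and>
     (\<forall>i < n^2. \<forall>j < n^2. mtrace (A i * A j) = (if i = j then 1 else 0))"

definition kron :: "complex mat \<Rightarrow> complex mat \<Rightarrow> complex mat" where
  "kron X Y = mat (dim_row X * dim_row Y) (dim_col X * dim_col Y)
     (\<lambda>(i,j). X $$ (i div dim_row Y, j div dim_col Y) * Y $$ (i mod dim_row Y, j mod dim_col Y))"

text \<open>Correlation matrix C(sigma)_{ij} = tr(sigma (A_i (x) B_j)) (a real number).\<close>
definition corr_mat :: "nat \<Rightarrow> nat \<Rightarrow> (nat \<Rightarrow> complex mat) \<Rightarrow> (nat \<Rightarrow> complex mat)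
    \<Rightarrow> complex mat \<Rightarrow> real mat" where
  "corr_mat dA dB A B \<sigma> = mat (dA^2) (dB^2) (\<lambda>(i,j). Re (mtrace (\<sigma> * kron (A i) (B j))))"

definition sing_vals :: "real mat \<Rightarrow> real list" where
  "sing_vals C = take (min (dim_row C) (dim_col C))
     (rev (sorted_list_of_multiset (image_mset sqrt (proots (char_poly (C * transpose_mat C))))))"

definition minor_norm :: "nat \<Rightarrow> real \<Rightarrow> real mat \<Rightarrow> real" where
  "minor_norm h p C = (let s = sing_vals C in
     (\<Sum>R \<in> {R. R \<subseteq> {0..<length s} \<and> card R = h}. \<Prod>k\<in>R. (s ! k) powr p) powr (1/p))"

definition CMN :: "nat \<Rightarrow> nat \<Rightarrow> (nat \<Rightarrow> complex mat) \<Rightarrow> (nat \<Rightarrow> complex mat)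
    \<Rightarrow> nat \<Rightarrow> real \<Rightarrow> complex mat \<Rightarrow> real" where
  "CMN dA dB A B h p \<sigma> = minor_norm h p (corr_mat dA dB A B \<sigma>)"

definition onb_vecs :: "nat \<Rightarrow> (nat \<Rightarrow> complex vec) \<Rightarrow> bool" where
  "onb_vecs n u \<longleftrightarrow> (\<forall>l < n. u l \<in> carrier_vec n) \<and>
     (\<forall>l < n. \<forall>k < n. conjugate (u l) \<bullet> u k = (if l = k then 1 else 0))"

definition proj :: "complex vec \<Rightarrow> complex mat" where
  "proj v = mat (dim_vec v) (dim_vec v) (\<lambda>(i,j). v $ i * cnj (v $ j))"

definition meas_A :: "nat \<Rightarrow> nat \<Rightarrow> (nat \<Rightarrow> complex vec) \<Rightarrow> complex mat \<Rightarrow> complex mat" where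
  "meas_A dA dB u \<rho> = mat (dA*dB) (dA*dB) (\<lambda>(i,j).
     \<Sum>l<dA. (kron (proj (u l)) (1\<^sub>m dB) * \<rho> * kron (proj (u l)) (1\<^sub>m dB)) $$ (i,j))"

definition discord_hp :: "nat \<Rightarrow> nat \<Rightarrow> (nat \<Rightarrow> complex mat) \<Rightarrow> (nat \<Rightarrow> complex mat)
    \<Rightarrow> nat \<Rightarrow> real \<Rightarrow> complex mat \<Rightarrow> real" where
  "discord_hp dA dB A B h p \<rho> = (CMN dA dB A B h p \<rho>) powr p
     - Sup {(CMN dA dB A B h p (meas_A dA dB u \<rho>)) powr p | u. onb_vecs dA u}"

definition cq_state :: "nat \<Rightarrow> nat \<Rightarrow> complex mat \<Rightarrow> bool" where
  "cq_state dA dB \<chi> \<longleftrightarrow> (\<exists>u pr ch. onb_vecs dA u \<and> (\<forall>k<dA. 0 \<le> pr k) \<and>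
     (\<Sum>k<dA. pr k) = (1::real) \<and> (\<forall>k<dA. density_mat dB (ch k)) \<and>
     \<chi> = mat (dA*dB) (dA*dB) (\<lambda>(i,j).
        \<Sum>k<dA. (complex_of_real (pr k) \<cdot>\<^sub>m kron (proj (u k)) (ch k)) $$ (i,j)))"

definition frob_sq :: "complex mat \<Rightarrow> real" where
  "frob_sq X = (\<Sum>i<dim_row X. \<Sum>j<dim_col X. (cmod (X $$ (i,j)))^2)"

text \<open>Geometric discord: min over cq states (the minimum is attained; we write Inf).\<close>
definition geo_discord :: "nat \<Rightarrow> nat \<Rightarrow> complex mat \<Rightarrow> real" where
  "geo_discord dA dB \<rho> = Inf {frob_sq (\<rho> - \<chi>) | \<chi>. cq_state dA dB \<chi>}"

end

theory Submission
  imports Defs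
begin

text \<open>Realigning \<open>\<rho>\<close> to the \<open>dA\<^sup>2 \<times> dB\<^sup>2\<close> matrix \<open>R\<close> with entries
  \<open>R((a,a'),(b,b')) = \<rho>((a,b),(a',b'))\<close> turns the change to the Hermitian bases into multiplication by
  unitaries, so the singular values of the correlation matrix are those of \<open>R\<close>. A measurement in the
  basis \<open>u\<close> multiplies \<open>R\<close> by the orthogonal projection onto the span of the vectorised projectors
  of \<open>u\<close>, and by the min--max principle this lowers every singular value; hence the discord is nonnegative.

  For \<open>h = 1\<close>, and for \<open>h = 2\<close> when the second singular value is positive, the symmetric function is
  strictly monotone at the singular values of \<open>R\<close>. Along a maximising sequence of measurements
  it therefore converges to its value at \<open>\<rho>\<close> iff every singular value converges, a condition
  that depends on neither \<open>h\<close> nor \<open>p\<close>. For \<open>h = 1\<close> and \<open>p = 2\<close> the symmetric function is the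
  squared Frobenius norm, and the deficit is the squared distance from \<open>\<rho>\<close> to the measured state,
  which is the closest classical-quantum state with basis \<open>u\<close>; so the condition says that the
  geometric discord vanishes. Working with sequences avoids any compactness argument. In the
  remaining case \<open>h = 2\<close> with second singular value zero, \<open>\<rho>\<close> is a product and both discords vanish.\<close>

subsection \<open>Adjoints and unitary diagonalisation\<close>

lemma mat_adjoint_dim [simp]:
  "dim_row (mat_adjoint A) = dim_col A" "dim_col (mat_adjoint A) = dim_row A"
  by (simp_all add: mat_adjoint_def)

lemma mat_adjoint_carrier [simp]:
  "A \<in> carrier_mat m n \<Longrightarrow> mat_adjoint A \<in> carrier_mat n m"
  by (metis carrier_matD carrier_matI mat_adjoint_dim)

lemma mat_adjoint_index [simp]:
  fixes A :: "complex mat"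
  assumes "i < dim_col A" "j < dim_row A"
  shows "mat_adjoint A $$ (i, j) = cnj (A $$ (j, i))"
  using assms by (simp add: mat_adjoint_def mat_of_rows_def)

declare index_mult_mat(1) [simp del]

text \<open>Entries of products are expanded as sums over an explicit index; the scalar-product form
  is taken out of the simpset so that the two do not compete.\<close>

lemma mult_mat_index:
  assumes "A \<in> carrier_mat m n" "B \<in> carrier_mat n k" "i < m" "j < k"
  shows "(A * B) $$ (i, j) = (\<Sum>l<n. A $$ (i, l) * B $$ (l, j))"
  using assms by (auto simp: index_mult_mat(1) scalar_prod_def lessThan_atLeast0)

lemma mat_adjoint_mult:
  fixes A :: "complex mat"
  assumes A: "A \<in> carrier_mat m n" and B: "B \<in> carrier_mat n k"
  shows "mat_adjoint (A * B) = mat_adjoint B * mat_adjoint A"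
proof (rule eq_matI)
  fix i j assume "i < dim_row (mat_adjoint B * mat_adjoint A)" "j < dim_col (mat_adjoint B * mat_adjoint A)"
  hence ij: "i < k" "j < m" using A B by auto
  show "mat_adjoint (A * B) $$ (i, j) = (mat_adjoint B * mat_adjoint A) $$ (i, j)"
    using ij A B by (subst mat_adjoint_index)
      (auto simp: mult_mat_index[OF A B] mult_mat_index[of _ k n _ m] mult.commute intro!: sum.cong)
qed (use A B in auto)

lemma mat_adjoint_adjoint [simp]: "mat_adjoint (mat_adjoint A) = (A :: complex mat)"
  by (rule eq_matI) auto

lemma mat_adjoint_one [simp]: "mat_adjoint (1\<^sub>m n) = (1\<^sub>m n :: complex mat)"
  by (rule eq_matI) auto

lemma mat_adjoint_four_block_diag:
  fixes A B :: "complex mat"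
  assumes "A \<in> carrier_mat k k" "B \<in> carrier_mat n n"
  shows "mat_adjoint (four_block_mat A (0\<^sub>m k n) (0\<^sub>m n k) B)
    = four_block_mat (mat_adjoint A) (0\<^sub>m k n) (0\<^sub>m n k) (mat_adjoint B)"
  using assms by (intro eq_matI) auto

definition unitary_mat :: "nat \<Rightarrow> complex mat \<Rightarrow> bool" where
  "unitary_mat n W \<longleftrightarrow> W \<in> carrier_mat n n \<and> mat_adjoint W * W = 1\<^sub>m n"

text \<open>A left inverse of a square matrix is also a right inverse.\<close>

lemma unitary_mat_right:
  assumes "unitary_mat n W"
  shows "W * mat_adjoint W = 1\<^sub>m n"
  using assms mat_mult_left_right_inverse[of "mat_adjoint W" n W] by (auto simp: unitary_mat_def)

lemma unitary_mat_mult: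
  assumes "unitary_mat n V" "unitary_mat n W"
  shows "unitary_mat n (V * W)"
proof -
  have c: "V \<in> carrier_mat n n" "W \<in> carrier_mat n n"
    and u: "mat_adjoint V * V = 1\<^sub>m n" "mat_adjoint W * W = 1\<^sub>m n"
    using assms by (auto simp: unitary_mat_def)
  have "mat_adjoint (V * W) * (V * W) = mat_adjoint W * mat_adjoint V * (V * W)"
    by (simp add: mat_adjoint_mult[OF c])
  also have "\<dots> = mat_adjoint W * (mat_adjoint V * (V * W))"
    by (rule assoc_mult_mat) (use c in auto)
  also have "mat_adjoint V * (V * W) = mat_adjoint V * V * W"
    by (rule assoc_mult_mat[symmetric]) (use c in auto)
  finally show ?thesis using c u by (simp add: unitary_mat_def)
qed

text \<open>Gram--Schmidt applied to a basis starting with the given vector, then normalisation.\<close>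
lemma unitary_mat_with_first_col:
  fixes v :: "complex vec"
  assumes v: "v \<in> carrier_vec n" and v0: "v \<noteq> 0\<^sub>v n"
  obtains W c where "unitary_mat n W" "col W 0 = c \<cdot>\<^sub>v v"
proof -
  interpret cof_vec_space n "TYPE(complex)" .
  define b where "b = basis_completion v"
  define ws where "ws = gram_schmidt n b"
  from basis_completion[OF v v0, folded b_def]
  have span_b: "span (set b) = carrier_vec n" and dist_b: "distinct b" 
    and indep: "\<not> lin_dep (set b)" and b: "set b \<subseteq> carrier_vec n" and hdb: "hd b = v" 
    and len_b: "length b = n" by auto
  have n: "n \<noteq> 0" using v v0 by auto
  from hdb len_b n obtain vs where bv: "b = v # vs" by (cases b, auto)
  from gram_schmidt_result[OF b dist_b indep refl, folded ws_def]
  have ws: "set ws \<subseteq> carrier_vec n" "corthogonal ws" "length ws = n" 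
    by (auto simp: len_b)
  have hdws: "hd ws = v" unfolding ws_def bv by (rule gram_schmidt_hd[OF v])
  have ws0: "ws ! 0 = v" using hdws ws(3) n by (cases ws) auto
  have wsc: "ws ! i \<in> carrier_vec n" if "i < n" for i using ws that by auto
  \<comment> \<open>\<open>a i\<close> is the Euclidean norm of the vector \<open>ws ! i\<close>; it
    is nonzero because \<open>ws\<close> is \<open>corthogonal\<close>.\<close>
  define a where "a i = complex_of_real (sqrt (\<Sum>l<n. (cmod (ws ! i $ l))\<^sup>2))" for i
  have sp: "ws ! i \<bullet>c ws ! j = (\<Sum>l<n. ws ! i $ l * cnj (ws ! j $ l))" if "i < n" "j < n" for i j
    using wsc[OF that(1)] wsc[OF that(2)] by (auto simp: scalar_prod_def lessThan_atLeast0)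
  have a2: "a i * a i = ws ! i \<bullet>c ws ! i" if "i < n" for i
    unfolding sp[OF that that] a_def of_real_mult[symmetric]
    by (simp add: sum_nonneg complex_norm_square[symmetric])
  have cs: "cnj (a i) = a i" for i by (simp add: a_def)
  have a0: "a i \<noteq> 0" if "i < n" for i
    using a2[OF that] corthogonalD[OF ws(2), of i i] that ws(3) by auto
  define W where "W = mat n n (\<lambda>(l, i). ws ! i $ l / a i)"
  have "mat_adjoint W * W = 1\<^sub>m n"
  proof (rule eq_matI)
    fix i j assume "i < dim_row (1\<^sub>m n)" "j < dim_col (1\<^sub>m n)"
    hence ij: "i < n" "j < n" by auto
    have "(mat_adjoint W * W) $$ (i, j) = (\<Sum>l<n. cnj (ws ! i $ l / a i) * (ws ! j $ l / a j))"
      using ij by (subst mult_mat_index[of _ n n _ n]) (auto simp: W_def)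
    also have "\<dots> = (ws ! j \<bullet>c ws ! i) / (a i * a j)"
      unfolding sp[OF ij(2,1)] sum_divide_distrib
      by (intro sum.cong) (simp_all add: cs mult.commute)
    also have "\<dots> = (if i = j then 1 else 0)"
      using a2[OF ij(1)] a0[OF ij(1)] corthogonalD[OF ws(2), of j i] ij ws(3) by auto
    finally show "(mat_adjoint W * W) $$ (i, j) = 1\<^sub>m n $$ (i, j)" using ij by simp
  qed (auto simp: W_def)
  moreover have "col W 0 = (1 / a 0) \<cdot>\<^sub>v v"
    using n v by (intro eq_vecI) (auto simp: W_def ws0)
  ultimately show ?thesis using that[of W "1 / a 0"] by (auto simp: unitary_mat_def W_def)
qed

lemma mat_diag_index [simp]:
  "i < n \<Longrightarrow> j < n \<Longrightarrow> mat_diag n f $$ (i, j) = (if i = j then f j else 0)"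
  by (simp add: mat_diag_def)

lemma mat_diag_dim [simp]: "dim_row (mat_diag n f) = n" "dim_col (mat_diag n f) = n"
  by (simp_all add: mat_diag_def)

lemma mat_conj_mult:
  fixes A V W :: "complex mat"
  assumes c: "A \<in> carrier_mat n n" "V \<in> carrier_mat n n" "W \<in> carrier_mat n n"
  shows "mat_adjoint (V * W) * A * (V * W) = mat_adjoint W * (mat_adjoint V * A * V) * W"
proof -
  have "mat_adjoint (V * W) * A * (V * W) = mat_adjoint W * mat_adjoint V * A * V * W"
    by (subst mat_adjoint_mult[OF c(2,3)], subst assoc_mult_mat[of _ n n _ n _ n]) (use c in auto)
  also have "mat_adjoint W * mat_adjoint V * A * V = mat_adjoint W * (mat_adjoint V * A * V)"
    using c by (simp add: assoc_mult_mat[of _ n n _ n _ n] mult_carrier_mat[of _ n n])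
  finally show ?thesis .
qed

text \<open>Deflation: a unitary whose first column is an eigenvector for \<open>e\<close> splits
  off a 1 x 1 block, and the remaining block is again Hermitian. The list \<open>es\<close> is
  prescribed so that the eigenvalues can be put on the diagonal in any chosen order.\<close>

theorem hermitian_unitarily_diagonalizable:
  fixes A :: "complex mat"
  assumes "A \<in> carrier_mat n n" "mat_adjoint A = A"
    and "char_poly A = (\<Prod>e\<leftarrow>es. [:- e, 1:])"
  shows "\<exists>W. unitary_mat n W \<and> mat_adjoint W * A * W = mat_diag n ((!) es)"
  using assms
proof (induction es arbitrary: n A)
  case Nil
  hence "n = 0" using degree_monic_char_poly[of A n] by auto
  thus ?case using Nil by (intro exI[of _ "1\<^sub>m 0"]) (auto simp: unitary_mat_def)
next
  case (Cons e es)
  have A: "A \<in> carrier_mat n n" and hA: "mat_adjoint A = A" by fact+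
  have cp: "char_poly A = [:- e, 1:] * (\<Prod>e\<leftarrow>es. [:- e, 1:])" using Cons.prems by simp
  have "eigenvalue A e"
    unfolding eigenvalue_root_char_poly[OF A] cp by simp
  then obtain v where "eigenvector A v e" unfolding eigenvalue_def by auto
  hence v: "v \<in> carrier_vec n" "v \<noteq> 0\<^sub>v n" "A *\<^sub>v v = e \<cdot>\<^sub>v v"
    using A by (auto simp: eigenvector_def)
  obtain m where n: "n = Suc m" using v by (cases n) auto
  obtain V c where V: "unitary_mat n V" and c: "col V 0 = c \<cdot>\<^sub>v v"
    using unitary_mat_with_first_col[OF v(1,2)] by blast
  have Vc: "V \<in> carrier_mat n n" and Vu: "mat_adjoint V * V = 1\<^sub>m n"
    using V by (auto simp: unitary_mat_def)
  define A' where "A' = mat_adjoint V * A * V"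
  have A'c: "A' \<in> carrier_mat n n" using A Vc by (simp add: A'_def mult_carrier_mat[of _ n n _ n])
  have hA': "mat_adjoint A' = A'"
    using A Vc by (simp add: A'_def mat_adjoint_mult[of _ n n _ n] hA assoc_mult_mat[of _ n n _ n _ n]
        mult_carrier_mat[of _ n n _ n])
  have colAV: "col (A * V) 0 = e \<cdot>\<^sub>v col V 0"
  proof -
    have "col (A * V) 0 = A *\<^sub>v (c \<cdot>\<^sub>v v)"
      unfolding c[symmetric] by (rule col_mult2[OF A Vc]) (simp add: n)
    also have "\<dots> = c \<cdot>\<^sub>v (e \<cdot>\<^sub>v v)" using mult_mat_vec[OF A v(1)] v(3) by simp
    finally show ?thesis by (simp add: c smult_smult_assoc mult.commute)
  qed
  have AV: "(A * V) $$ (l, 0) = e * V $$ (l, 0)" if "l < n" for l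
  proof -
    have "(A * V) $$ (l, 0) = col (A * V) 0 $ l"
      by (rule index_col[symmetric]) (use that A Vc n in auto)
    thus ?thesis unfolding colAV using that Vc n by simp
  qed
  have A'0: "A' $$ (i, 0) = (if i = 0 then e else 0)" if i: "i < n" for i
  proof -
    have "A' = mat_adjoint V * (A * V)"
      unfolding A'_def by (rule assoc_mult_mat) (use A Vc in auto)
    hence "A' $$ (i, 0) = (\<Sum>l<n. mat_adjoint V $$ (i, l) * (A * V) $$ (l, 0))"
      using A Vc i by (simp add: mult_mat_index[of "mat_adjoint V" n n "A * V" n])
    also have "\<dots> = e * (mat_adjoint V * V) $$ (i, 0)"
      using Vc AV i by (subst mult_mat_index[of _ n n _ n])
        (auto simp: sum_distrib_left mult_ac intro!: sum.cong)
    finally show ?thesis using Vu i n by simp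
  qed
  \<comment> \<open>The first row vanishes off the diagonal because \<open>A'\<close> is Hermitian
    and its first column is known.\<close>
  have A'0': "A' $$ (0, j) = 0" if "j < n" "j \<noteq> 0" for j
    using that A'c A'0[of j] arg_cong[OF hA', of "\<lambda>M. M $$ (0, j)"] n by simp
  define E where "E = mat 1 1 (\<lambda>_. e)"
  define B where "B = mat m m (\<lambda>(i, j). A' $$ (Suc i, Suc j))"
  have Ec: "E \<in> carrier_mat 1 1" and Bc: "B \<in> carrier_mat m m" by (auto simp: E_def B_def)
  have blk: "A' = four_block_mat E (0\<^sub>m 1 m) (0\<^sub>m m 1) B"
    using A'c n A'0 A'0' by (intro eq_matI) (auto simp: E_def B_def)
  have hB: "mat_adjoint B = B"
  proof (rule eq_matI)
    fix i j assume "i < dim_row B" "j < dim_col B"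
    hence ij: "i < m" "j < m" by (auto simp: B_def)
    thus "mat_adjoint B $$ (i, j) = B $$ (i, j)"
      using A'c n arg_cong[OF hA', of "\<lambda>M. M $$ (Suc i, Suc j)"] by (simp add: B_def)
  qed (auto simp: B_def)
  \<comment> \<open>By similarity, cancelling the linear factor of the 1 x 1 block leaves
    \<open>es\<close> as the list of roots for \<open>B\<close>.\<close>
  have "similar_mat_wit A' A (mat_adjoint V) V"
    by (rule similar_mat_witI[of _ _ n]) (use A Vc A'c Vu unitary_mat_right[OF V] in \<open>auto simp: A'_def\<close>)
  hence "char_poly A = char_poly A'"
    using char_poly_similar[of A' A] unfolding similar_mat_def by metis
  also have "\<dots> = char_poly E * char_poly B"
    unfolding blk by (rule char_poly_four_block_zeros_col) (use Ec Bc in auto)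
  also have "char_poly E = [:- e, 1:]"
    by (simp add: E_def char_poly_defs det_def sign_def)
  finally have "char_poly B = (\<Prod>e\<leftarrow>es. [:- e, 1:])"
    using cp by (metis mult_cancel_left pCons_eq_0_iff zero_neq_one)
  from Cons.IH[OF Bc hB this] obtain U where U: "unitary_mat m U"
    and UB: "mat_adjoint U * B * U = mat_diag m ((!) es)" by blast
  have Uc: "U \<in> carrier_mat m m" using U by (simp add: unitary_mat_def)
  \<comment> \<open>The diagonaliser of \<open>B\<close> is extended by 1 in the first coordinate;
    \<open>V * T\<close> then diagonalises \<open>A\<close>.\<close>
  define T where "T = four_block_mat (1\<^sub>m 1) (0\<^sub>m 1 m) (0\<^sub>m m 1) U"
  have Tc: "T \<in> carrier_mat n n" using Uc n by (auto simp: T_def)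
  have T': "mat_adjoint T = four_block_mat (1\<^sub>m 1) (0\<^sub>m 1 m) (0\<^sub>m m 1) (mat_adjoint U)"
    unfolding T_def using Uc by (subst mat_adjoint_four_block_diag) auto
  have "mat_adjoint T * T = four_block_mat (1\<^sub>m 1) (0\<^sub>m 1 m) (0\<^sub>m m 1) (1\<^sub>m m)"
    unfolding T' unfolding T_def using U Uc
    by (subst mult_four_block_mat[of _ 1 1 _ m _ m _ _ 1 _ m]) (auto simp: unitary_mat_def)
  also have "\<dots> = 1\<^sub>m n" using n by (intro eq_matI) auto
  finally have T: "unitary_mat n T" using Tc by (simp add: unitary_mat_def)
  have "mat_adjoint T * A' * T = four_block_mat E (0\<^sub>m 1 m) (0\<^sub>m m 1) (mat_diag m ((!) es))"
    unfolding T' blk unfolding T_def UB[symmetric] using Uc Ec Bc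
    by (subst mult_four_block_mat[of _ 1 1 _ m _ m _ _ 1 _ m], auto,
        subst mult_four_block_mat[of _ 1 1 _ m _ m _ _ 1 _ m],
        auto simp: left_add_zero_mat[of _ m m] mult_carrier_mat[of _ m m _ m])
  also have "\<dots> = mat_diag n ((!) (e # es))"
    using n by (intro eq_matI) (auto simp: E_def mat_diag_def nth_Cons')
  finally have "mat_adjoint (V * T) * A * (V * T) = mat_diag n ((!) (e # es))"
    by (subst mat_conj_mult[OF A Vc Tc]) (simp add: A'_def)
  thus ?case using unitary_mat_mult[OF V T] by blast
qed

section \<open>The sorted real spectrum of a Hermitian matrix\<close>

definition herm_eigs :: "complex mat \<Rightarrow> real list" where
  "herm_eigs N = rev (sorted_list_of_multiset (image_mset Re (proots (char_poly N))))"

lemma proots_prod_linear: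
  fixes es :: "'a :: idom list"
  shows "proots (\<Prod>e\<leftarrow>es. [:- e, 1:]) = mset es"
proof (induction es)
  case (Cons e es)
  have "(\<Prod>e\<leftarrow>es. [:- e, 1:]) \<noteq> (0 :: 'a poly)" by auto
  hence "proots ([:- e, 1:] * (\<Prod>e\<leftarrow>es. [:- e, 1:])) = {#e#} + mset es"
    using Cons by (subst proots_mult) auto
  thus ?case by simp
qed simp

lemma herm_eigs_antimono:
  assumes "i \<le> j" "j < length (herm_eigs N)"
  shows "herm_eigs N ! j \<le> herm_eigs N ! i"
  using assms unfolding herm_eigs_def
  by (auto intro!: sorted_rev_nth_mono)

text \<open>The diagonalisation is used twice. With an arbitrary factorisation of the characteristic
  polynomial it shows that the diagonal, being Hermitian, is real; hence the real parts in
  \<open>herm_eigs\<close> change no root, and a second run with the list \<open>herm_eigs N\<close>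
  gives a decreasing diagonal.\<close>

lemma hermitian_spectral:
  fixes N :: "complex mat"
  assumes N: "N \<in> carrier_mat n n" and h: "mat_adjoint N = N"
  shows length_herm_eigs: "length (herm_eigs N) = n"
    and char_poly_herm_eigs: "char_poly N = (\<Prod>e\<leftarrow>herm_eigs N. [:- complex_of_real e, 1:])"
    and "\<exists>W. unitary_mat n W \<and>
      mat_adjoint W * N * W = mat_diag n (\<lambda>i. complex_of_real (herm_eigs N ! i))"
proof -
  obtain es where es: "char_poly N = (\<Prod>e\<leftarrow>es. [:- e, 1:])" "length es = n"
    using char_poly_factorized[OF N] by blast
  obtain V where V: "unitary_mat n V" "mat_adjoint V * N * V = mat_diag n ((!) es)"
    using hermitian_unitarily_diagonalizable[OF N h es(1)] by blast
  have Vc: "V \<in> carrier_mat n n" using V by (simp add: unitary_mat_def)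
  have "mat_adjoint (mat_adjoint V * N * V) = mat_adjoint V * N * V"
    using N Vc by (simp add: mat_adjoint_mult[of _ n n _ n] h assoc_mult_mat[of _ n n _ n _ n]
        mult_carrier_mat[of _ n n _ n])
  hence hd: "mat_adjoint (mat_diag n ((!) es)) = mat_diag n ((!) es)" unfolding V(2) .
  have "cnj (es ! i) = es ! i" if "i < n" for i
    using that arg_cong[OF hd, of "\<lambda>M. M $$ (i, i)"] by simp
  hence re: "complex_of_real (Re e) = e" if "e \<in> set es" for e
    using that es(2) by (auto simp: in_set_conv_nth complex_eq_iff)
  have ms: "mset (herm_eigs N) = mset (map Re es)"
    by (simp add: herm_eigs_def es(1) proots_prod_linear)
  show len: "length (herm_eigs N) = n"
    using arg_cong[OF ms, of size] es(2) by simp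
  have "mset (map complex_of_real (herm_eigs N)) = mset es"
    using image_mset_cong[of "mset es" "\<lambda>e. complex_of_real (Re e)" "\<lambda>e. e"] re
    by (simp add: ms multiset.map_comp comp_def)
  hence "(\<Prod>e\<in>#mset (map complex_of_real (herm_eigs N)). [:- e, 1:]) = (\<Prod>e\<in>#mset es. [:- e, 1:])"
    by simp
  hence "(\<Prod>e\<leftarrow>map complex_of_real (herm_eigs N). [:- e, 1:]) = (\<Prod>e\<leftarrow>es. [:- e, 1:])"
    by (simp only: prod_mset_prod_list[symmetric] mset_map[symmetric])
  hence cp: "char_poly N = (\<Prod>e\<leftarrow>map complex_of_real (herm_eigs N). [:- e, 1:])"
    using es(1) by simp
  thus "char_poly N = (\<Prod>e\<leftarrow>herm_eigs N. [:- complex_of_real e, 1:])" by (simp add: comp_def)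
  obtain W where W: "unitary_mat n W"
      "mat_adjoint W * N * W = mat_diag n ((!) (map complex_of_real (herm_eigs N)))"
    using hermitian_unitarily_diagonalizable[OF N h cp] by blast
  have "mat_diag n ((!) (map complex_of_real (herm_eigs N)))
      = mat_diag n (\<lambda>i. complex_of_real (herm_eigs N ! i))"
    by (rule eq_matI) (auto simp: len)
  with W show "\<exists>W. unitary_mat n W \<and>
      mat_adjoint W * N * W = mat_diag n (\<lambda>i. complex_of_real (herm_eigs N ! i))" by auto
qed

text \<open>There are \<open>k\<close> equations in \<open>k + 1\<close> unknowns; a zero row makes
  the coefficient matrix square and singular.\<close>

lemma homogeneous_system_nontrivial:
  fixes K :: "nat \<Rightarrow> nat \<Rightarrow> 'a :: field"
  obtains c where "\<exists>i\<le>k. c i \<noteq> 0" "\<And>j. j < k \<Longrightarrow> (\<Sum>i\<le>k. K j i * c i) = 0"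
proof -
  define M where "M = mat\<^sub>r (Suc k) (Suc k) (\<lambda>j. if j = k then 0\<^sub>v (Suc k) else vec (Suc k) (K j))"
  have M: "M \<in> carrier_mat (Suc k) (Suc k)" by (simp add: M_def)
  have "det M = 0" unfolding M_def by (rule det_row_0) auto
  then obtain v where v: "v \<in> carrier_vec (Suc k)" "v \<noteq> 0\<^sub>v (Suc k)" "M *\<^sub>v v = 0\<^sub>v (Suc k)"
    using det_0_iff_vec_prod_zero_field[OF M] by auto
  have "\<exists>i\<le>k. v $ i \<noteq> 0"
    using v(1,2) by (metis carrier_vecD eq_vecI index_zero_vec less_Suc_eq_le)
  moreover have "(\<Sum>i\<le>k. K j i * v $ i) = 0" if "j < k" for j
  proof -
    have "(M *\<^sub>v v) $ j = (\<Sum>i\<le>k. K j i * v $ i)"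
      using that v(1) by (auto simp: M_def mult_mat_vec_def scalar_prod_def
          atLeast0LessThan lessThan_Suc_atMost simp del: sum.lessThan_Suc intro!: sum.cong)
    thus ?thesis using v(3) that by simp
  qed
  ultimately show ?thesis by (rule that)
qed

subsection \<open>The Frobenius norm\<close>

lemma frob_sq_nonneg: "0 \<le> frob_sq X"
  by (simp add: frob_sq_def sum_nonneg)

lemma frob_sq_carrier:
  "X \<in> carrier_mat m n \<Longrightarrow> frob_sq X = (\<Sum>i<m. \<Sum>j<n. (cmod (X $$ (i, j)))\<^sup>2)"
  by (auto simp: frob_sq_def)

lemma mtrace_adjoint_mult:
  assumes "X \<in> carrier_mat m n" "Y \<in> carrier_mat m n"
  shows "mtrace (mat_adjoint X * Y) = (\<Sum>i<m. \<Sum>j<n. cnj (X $$ (i, j)) * Y $$ (i, j))"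
proof -
  have "mtrace (mat_adjoint X * Y) = (\<Sum>j<n. \<Sum>i<m. cnj (X $$ (i, j)) * Y $$ (i, j))"
    using assms by (simp add: mtrace_def mult_mat_index[of _ n m _ n])
  thus ?thesis by (subst sum.swap)
qed

lemma frob_sq_eq_mtrace: "complex_of_real (frob_sq X) = mtrace (mat_adjoint X * X)"
  by (subst mtrace_adjoint_mult[of _ "dim_row X" "dim_col X"])
     (auto simp: frob_sq_def complex_norm_square[symmetric] mult.commute[of "cnj _"])

lemma frob_sq_isometry:
  assumes W: "W \<in> carrier_mat p m" "mat_adjoint W * W = 1\<^sub>m m" and X: "X \<in> carrier_mat m n"
  shows "frob_sq (W * X) = frob_sq X"
proof -
  have "mat_adjoint (W * X) * (W * X) = mat_adjoint X * mat_adjoint W * (W * X)"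
    by (simp add: mat_adjoint_mult[OF W(1) X])
  also have "\<dots> = mat_adjoint X * (mat_adjoint W * (W * X))"
    by (rule assoc_mult_mat) (use W X in auto)
  also have "mat_adjoint W * (W * X) = mat_adjoint W * W * X"
    by (rule assoc_mult_mat[symmetric]) (use W X in auto)
  also have "\<dots> = X" using W X by simp
  finally show ?thesis
    by (simp add: frob_sq_eq_mtrace flip: of_real_eq_iff[where 'a = complex])
qed

text \<open>The cross term is the real part of the trace of \<open>mat_adjoint (Q * Z) * Y\<close>,
  which contains the factor \<open>mat_adjoint Q * Y = 0\<close>.\<close>

lemma frob_sq_pythagoras:
  assumes Q: "Q \<in> carrier_mat m k" and Y: "Y \<in> carrier_mat m n" and Z: "Z \<in> carrier_mat k n"
    and orth: "mat_adjoint Q * Y = 0\<^sub>m k n"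
  shows "frob_sq (Y + Q * Z) = frob_sq Y + frob_sq (Q * Z)"
proof -
  have QZ: "Q * Z \<in> carrier_mat m n" using Q Z by simp
  have "mat_adjoint (Q * Z) * Y = mat_adjoint Z * mat_adjoint Q * Y"
    by (simp add: mat_adjoint_mult[OF Q Z])
  also have "\<dots> = mat_adjoint Z * (mat_adjoint Q * Y)"
    by (rule assoc_mult_mat) (use Q Y Z in auto)
  also have "\<dots> = 0\<^sub>m n n" unfolding orth using Z by (simp add: right_mult_zero_mat[of _ n k])
  finally have "mtrace (mat_adjoint (Q * Z) * Y) = 0" by (simp add: mtrace_def)
  hence "Re (\<Sum>i<m. \<Sum>j<n. cnj ((Q * Z) $$ (i, j)) * Y $$ (i, j)) = 0"
    unfolding mtrace_adjoint_mult[OF QZ Y] by simp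
  hence cross: "(\<Sum>i<m. \<Sum>j<n. Re (cnj ((Q * Z) $$ (i, j)) * Y $$ (i, j))) = 0"
    by (simp only: Re_sum)
  have cm: "(cmod (a + b))\<^sup>2 = (cmod a)\<^sup>2 + (cmod b)\<^sup>2 + 2 * Re (cnj b * a)" for a b
    by (simp add: cmod_power2 power2_sum algebra_simps)
  have "frob_sq (Y + Q * Z) = (\<Sum>i<m. \<Sum>j<n. (cmod (Y $$ (i, j)))\<^sup>2 + (cmod ((Q * Z) $$ (i, j)))\<^sup>2
      + 2 * Re (cnj ((Q * Z) $$ (i, j)) * Y $$ (i, j)))"
    unfolding cm[symmetric] using Y Q Z by (subst frob_sq_carrier[of _ m n]) auto
  also have "\<dots> = frob_sq Y + frob_sq (Q * Z)"
    using cross by (simp add: sum.distrib frob_sq_carrier[OF Y] frob_sq_carrier[OF QZ] flip: sum_distrib_left)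
  finally show ?thesis .
qed

subsection \<open>Singular values of a rectangular matrix\<close>

text \<open>The squared singular values of \<open>X\<close> in decreasing order, one for each row;
  if there are more rows than columns, the surplus entries are zero by
  \<open>gram_eigs_zero_beyond_cols\<close>.\<close>

definition gram_eigs :: "complex mat \<Rightarrow> real list" where
  "gram_eigs X = herm_eigs (X * mat_adjoint X)"

lemma gram_hermitian:
  fixes X :: "complex mat"
  assumes "X \<in> carrier_mat m n"
  shows "X * mat_adjoint X \<in> carrier_mat m m" "mat_adjoint (X * mat_adjoint X) = X * mat_adjoint X"
  using assms by (auto simp: mat_adjoint_mult[of _ m n _ m])

lemma length_gram_eigs: "X \<in> carrier_mat m n \<Longrightarrow> length (gram_eigs X) = m"
  unfolding gram_eigs_def by (intro length_herm_eigs gram_hermitian)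

lemma gram_eigs_antimono:
  "X \<in> carrier_mat m n \<Longrightarrow> i \<le> j \<Longrightarrow> j < m \<Longrightarrow> gram_eigs X ! j \<le> gram_eigs X ! i"
  using length_gram_eigs[of X m n] unfolding gram_eigs_def by (auto intro: herm_eigs_antimono)

text \<open>Half of a singular value decomposition: rotation by an eigenbasis of the Gram matrix
  makes the rows orthogonal, with squared lengths \<open>gram_eigs X\<close>. No right unitary is
  constructed.\<close>

lemma gram_eigs_diagonal_rows:
  assumes X: "X \<in> carrier_mat m n"
  obtains W Y where "unitary_mat m W" "Y = mat_adjoint W * X" "X = W * Y" "Y \<in> carrier_mat m n"
    "Y * mat_adjoint Y = mat_diag m (\<lambda>i. complex_of_real (gram_eigs X ! i))"
proof -
  obtain W where W: "unitary_mat m W"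
      "mat_adjoint W * (X * mat_adjoint X) * W = mat_diag m (\<lambda>i. complex_of_real (gram_eigs X ! i))"
    using hermitian_spectral(3)[OF gram_hermitian[OF X]] unfolding gram_eigs_def by blast
  have Wc: "W \<in> carrier_mat m m" using W by (simp add: unitary_mat_def)
  define Y where "Y = mat_adjoint W * X"
  have Yc: "Y \<in> carrier_mat m n" using Wc X by (simp add: Y_def mult_carrier_mat[of _ m m])
  have "W * Y = W * mat_adjoint W * X"
    unfolding Y_def by (rule assoc_mult_mat[symmetric]) (use Wc X in auto)
  hence XY: "X = W * Y" using unitary_mat_right[OF W(1)] X by simp
  have "Y * mat_adjoint Y = mat_adjoint W * X * (mat_adjoint X * W)"
    unfolding Y_def using Wc X by (simp add: mat_adjoint_mult[of _ m m _ n])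
  also have "\<dots> = mat_adjoint W * X * mat_adjoint X * W"
    by (rule assoc_mult_mat[symmetric, of _ m n _ m _ m]) (use Wc X in auto)
  also have "mat_adjoint W * X * mat_adjoint X = mat_adjoint W * (X * mat_adjoint X)"
    by (rule assoc_mult_mat) (use Wc X in auto)
  finally have "Y * mat_adjoint Y = mat_diag m (\<lambda>i. complex_of_real (gram_eigs X ! i))"
    using W(2) by simp
  thus ?thesis using that[OF W(1) Y_def XY Yc] by blast
qed

lemma row_norm_of_diagonal_gram:
  assumes Y: "Y \<in> carrier_mat m n" and D: "Y * mat_adjoint Y = mat_diag m (\<lambda>i. complex_of_real (l i))"
    and i: "i < m"
  shows "(\<Sum>j<n. (cmod (Y $$ (i, j)))\<^sup>2) = l i"
proof -
  have "complex_of_real (\<Sum>j<n. (cmod (Y $$ (i, j)))\<^sup>2) = (Y * mat_adjoint Y) $$ (i, i)"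
    using Y i by (simp add: mult_mat_index[of _ m n _ m] complex_norm_square[symmetric])
  thus ?thesis unfolding D using i by (simp del: of_real_sum of_real_power)
qed

lemma gram_eigs_nonneg:
  assumes X: "X \<in> carrier_mat m n" and i: "i < m"
  shows "0 \<le> gram_eigs X ! i"
proof -
  obtain W Y where "unitary_mat m W" "Y = mat_adjoint W * X" "X = W * Y" "Y \<in> carrier_mat m n"
    and "Y * mat_adjoint Y = mat_diag m (\<lambda>i. complex_of_real (gram_eigs X ! i))"
    by (rule gram_eigs_diagonal_rows[OF X])
  from row_norm_of_diagonal_gram[OF this(4,5) i] show ?thesis
    by (metis sum_nonneg zero_le_power2)
qed

text \<open>The left unitary preserves the Frobenius norm, and the rotated rows have squared lengths
  \<open>gram_eigs X ! i\<close>.\<close>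

lemma sum_gram_eigs:
  assumes X: "X \<in> carrier_mat m n"
  shows "(\<Sum>i<m. gram_eigs X ! i) = frob_sq X"
proof -
  obtain W Y where W: "unitary_mat m W" and XY: "Y = mat_adjoint W * X" "X = W * Y" and Y: "Y \<in> carrier_mat m n"
    and D: "Y * mat_adjoint Y = mat_diag m (\<lambda>i. complex_of_real (gram_eigs X ! i))"
    by (rule gram_eigs_diagonal_rows[OF X])
  have "frob_sq X = frob_sq Y"
    unfolding XY(2) by (rule frob_sq_isometry) (use W Y in \<open>auto simp: unitary_mat_def\<close>)
  also have "\<dots> = (\<Sum>i<m. gram_eigs X ! i)"
    unfolding frob_sq_carrier[OF Y] using row_norm_of_diagonal_gram[OF Y D] by simp
  finally show ?thesis by simp
qed

text \<open>By monotonicity all eigenvalues from index 1 on vanish, and so do the corresponding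
  rotated rows; only the first column of \<open>W\<close> times the first row of \<open>Y\<close> is
  left.\<close>

lemma rank_one_if_second_gram_eig_zero:
  assumes X: "X \<in> carrier_mat m n" and m: "1 < m" and z: "gram_eigs X ! 1 = 0"
  obtains w z where "\<And>i j. i < m \<Longrightarrow> j < n \<Longrightarrow> X $$ (i, j) = w i * z j"
proof -
  obtain W Y where W: "unitary_mat m W" and XY: "Y = mat_adjoint W * X" "X = W * Y" and Y: "Y \<in> carrier_mat m n"
    and D: "Y * mat_adjoint Y = mat_diag m (\<lambda>i. complex_of_real (gram_eigs X ! i))"
    by (rule gram_eigs_diagonal_rows[OF X])
  have Wc: "W \<in> carrier_mat m m" using W by (simp add: unitary_mat_def)
  have Y0: "Y $$ (i, j) = 0" if "i < m" "j < n" "i \<noteq> 0" for i j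
  proof -
    have "gram_eigs X ! i = 0"
      using gram_eigs_antimono[OF X, of 1 i] gram_eigs_nonneg[OF X, of i] that z by simp
    with row_norm_of_diagonal_gram[OF Y D that(1)] have "(\<Sum>j<n. (cmod (Y $$ (i, j)))\<^sup>2) = 0" by simp
    hence "\<forall>j<n. (cmod (Y $$ (i, j)))\<^sup>2 = 0" by (subst (asm) sum_nonneg_eq_0_iff) auto
    thus ?thesis using that by simp
  qed
  have "X $$ (i, j) = W $$ (i, 0) * Y $$ (0, j)" if "i < m" "j < n" for i j
  proof -
    have "X $$ (i, j) = (\<Sum>l<m. W $$ (i, l) * Y $$ (l, j))"
      unfolding XY(2) by (rule mult_mat_index[OF Wc Y that])
    also have "\<dots> = (\<Sum>l\<in>{0}. W $$ (i, l) * Y $$ (l, j))"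
      using m that Y0 by (intro sum.mono_neutral_right) auto
    finally show ?thesis by simp
  qed
  thus ?thesis using that[of "\<lambda>i. W $$ (i, 0)" "\<lambda>j. Y $$ (0, j)"] by blast
qed

text \<open>\<open>Y\<close> times its adjoint is diagonal, so the squared norm is a diagonal
  quadratic form in \<open>c\<close>.\<close>

lemma frob_sq_diagonal_gram:
  assumes Y: "Y \<in> carrier_mat m n" and D: "Y * mat_adjoint Y = mat_diag m (\<lambda>i. complex_of_real (l i))"
    and c: "c \<in> carrier_mat m 1"
  shows "frob_sq (mat_adjoint Y * c) = (\<Sum>i<m. l i * (cmod (c $$ (i, 0)))\<^sup>2)"
proof -
  have "mat_adjoint (mat_adjoint Y * c) * (mat_adjoint Y * c) = mat_adjoint c * Y * (mat_adjoint Y * c)"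
    using Y c by (simp add: mat_adjoint_mult[of _ n m _ 1])
  also have "\<dots> = mat_adjoint c * (Y * (mat_adjoint Y * c))"
    by (rule assoc_mult_mat) (use Y c in auto)
  also have "Y * (mat_adjoint Y * c) = Y * mat_adjoint Y * c"
    by (rule assoc_mult_mat[symmetric]) (use Y c in auto)
  finally have "complex_of_real (frob_sq (mat_adjoint Y * c))
      = mtrace (mat_adjoint c * (mat_diag m (\<lambda>i. complex_of_real (l i)) * c))"
    unfolding D frob_sq_eq_mtrace by simp
  also have "\<dots> = (\<Sum>i<m. cnj (c $$ (i, 0)) * (mat_diag m (\<lambda>i. complex_of_real (l i)) * c) $$ (i, 0))"
    using c by (subst mtrace_adjoint_mult[OF c]) (auto intro!: mult_carrier_mat[of _ m m])
  also have "\<dots> = (\<Sum>i<m. complex_of_real (l i * (cmod (c $$ (i, 0)))\<^sup>2))"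
  proof (intro sum.cong refl)
    fix i assume i: "i \<in> {..<m}"
    hence "(mat_diag m (\<lambda>i. complex_of_real (l i)) * c) $$ (i, 0) = complex_of_real (l i) * c $$ (i, 0)"
      using c by (subst mat_diag_mult_left[of _ m 1]) auto
    thus "cnj (c $$ (i, 0)) * (mat_diag m (\<lambda>i. complex_of_real (l i)) * c) $$ (i, 0)
        = complex_of_real (l i * (cmod (c $$ (i, 0)))\<^sup>2)"
      by (simp add: complex_norm_square[symmetric] mult.left_commute mult.commute[of "cnj _"])
  qed
  finally show ?thesis by (simp only: of_real_eq_iff flip: of_real_sum)
qed

text \<open>Test vectors supported on the first \<open>k + 1\<close> coordinates. The last claim is
  a Rayleigh bound from below, with weights at least \<open>t\<close> on the support.\<close>

lemma truncated_column:
  assumes k: "k < m" and c: "\<exists>i\<le>k. c i \<noteq> (0::complex)"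
  defines "v \<equiv> mat m 1 (\<lambda>(i, _). if i \<le> k then c i else 0)"
  shows "v \<in> carrier_mat m 1" "0 < frob_sq v"
    and "A \<in> carrier_mat p m \<Longrightarrow> j < p \<Longrightarrow> (A * v) $$ (j, 0) = (\<Sum>i\<le>k. A $$ (j, i) * c i)"
    and "(\<And>i. i \<le> k \<Longrightarrow> t \<le> l i) \<Longrightarrow> t * frob_sq v \<le> (\<Sum>i<m. l i * (cmod (v $$ (i, 0)))\<^sup>2)"
proof -
  show vc: "v \<in> carrier_mat m 1" by (simp add: v_def)
  have v: "v $$ (i, 0) = (if i \<le> k then c i else 0)" if "i < m" for i
    using that by (simp add: v_def)
  have fv: "frob_sq v = (\<Sum>i<m. (cmod (v $$ (i, 0)))\<^sup>2)" by (simp add: frob_sq_carrier[OF vc])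
  obtain i where i: "i \<le> k" "c i \<noteq> 0" using c by blast
  show "0 < frob_sq v" unfolding fv
    by (rule sum_pos2[of _ i]) (use i k v[of i] in auto)
  show "(A * v) $$ (j, 0) = (\<Sum>i\<le>k. A $$ (j, i) * c i)" if A: "A \<in> carrier_mat p m" "j < p"
  proof -
    have "(A * v) $$ (j, 0) = (\<Sum>i<m. A $$ (j, i) * v $$ (i, 0))"
      by (rule mult_mat_index[OF A(1) vc A(2)]) simp
    also have "\<dots> = (\<Sum>i\<le>k. A $$ (j, i) * v $$ (i, 0))"
      using k v by (intro sum.mono_neutral_right) auto
    also have "\<dots> = (\<Sum>i\<le>k. A $$ (j, i) * c i)" using k v by simp
    finally show ?thesis .
  qed
  show "t * frob_sq v \<le> (\<Sum>i<m. l i * (cmod (v $$ (i, 0)))\<^sup>2)" if "\<And>i. i \<le> k \<Longrightarrow> t \<le> l i"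
    unfolding fv sum_distrib_left using that v by (intro sum_mono) (auto intro: mult_right_mono)
qed

text \<open>The adjoint of \<open>Y\<close> has only \<open>n\<close> rows, so it kills a nonzero
  vector supported on \<open>k + 1 > n\<close> coordinates; the form is zero there, yet at least
  \<open>gram_eigs X ! k\<close> times the squared norm.\<close>

lemma gram_eigs_zero_beyond_cols:
  assumes X: "X \<in> carrier_mat m n" and k: "n \<le> k" "k < m"
  shows "gram_eigs X ! k = 0"
proof -
  obtain W Y where W: "unitary_mat m W" and XY: "Y = mat_adjoint W * X" "X = W * Y" and Y: "Y \<in> carrier_mat m n"
    and D: "Y * mat_adjoint Y = mat_diag m (\<lambda>i. complex_of_real (gram_eigs X ! i))"
    by (rule gram_eigs_diagonal_rows[OF X])
  \<comment> \<open>For \<open>j \<ge> n\<close> the coefficients lie outside the matrix and are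
    arbitrary; these extra equations only restrict \<open>c\<close> further.\<close>
  obtain c where c: "\<exists>i\<le>k. c i \<noteq> 0" "\<And>j. j < k \<Longrightarrow> (\<Sum>i\<le>k. mat_adjoint Y $$ (j, i) * c i) = 0"
    by (rule homogeneous_system_nontrivial[of k "\<lambda>j i. mat_adjoint Y $$ (j, i)"]) blast
  define v where "v = mat m 1 (\<lambda>(i, _). if i \<le> k then c i else 0)"
  note v = truncated_column[OF k(2) c(1), folded v_def]
  have "gram_eigs X ! k * frob_sq v \<le> frob_sq (mat_adjoint Y * v)"
    unfolding frob_sq_diagonal_gram[OF Y D v(1)]
    by (rule v(4)) (use gram_eigs_antimono[OF X] k in auto)
  also have "\<dots> = 0"
  proof -
    have "(mat_adjoint Y * v) $$ (j, 0) = 0" if "j < n" for j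
      using v(3)[of "mat_adjoint Y" n j] c(2)[of j] Y k that by simp
    thus ?thesis using Y v(1) by (subst frob_sq_carrier[of _ n 1]) auto
  qed
  finally have "gram_eigs X ! k \<le> 0" using v(2) by (simp add: mult_le_0_iff)
  thus ?thesis using gram_eigs_nonneg[OF X k(2)] by simp
qed

text \<open>The min--max argument: some vector in the span of the top \<open>k + 1\<close> eigenvectors for \<open>P X\<close>
  is mapped by \<open>P\<^sup>*\<close> into the orthogonal complement of the top \<open>k\<close> eigenvectors for \<open>X\<close>.\<close>
lemma gram_eigs_contraction_le:
  assumes X: "X \<in> carrier_mat m n" and P: "P \<in> carrier_mat m m"
    and contr: "\<And>v. v \<in> carrier_mat m 1 \<Longrightarrow> frob_sq (mat_adjoint P * v) \<le> frob_sq v"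
    and k: "k < m"
  shows "gram_eigs (P * X) ! k \<le> gram_eigs X ! k"
proof -
  have PX: "P * X \<in> carrier_mat m n" using P X by simp
  obtain W Y where W: "unitary_mat m W" and XY: "Y = mat_adjoint W * X" "X = W * Y" and Y: "Y \<in> carrier_mat m n"
    and D: "Y * mat_adjoint Y = mat_diag m (\<lambda>i. complex_of_real (gram_eigs X ! i))"
    by (rule gram_eigs_diagonal_rows[OF X])
  obtain W' Y' where W': "unitary_mat m W'" and XY': "Y' = mat_adjoint W' * (P * X)" "P * X = W' * Y'"
    and Y': "Y' \<in> carrier_mat m n"
    and D': "Y' * mat_adjoint Y' = mat_diag m (\<lambda>i. complex_of_real (gram_eigs (P * X) ! i))"
    by (rule gram_eigs_diagonal_rows[OF PX])
  have Wc: "W \<in> carrier_mat m m" "W' \<in> carrier_mat m m" using W W' by (auto simp: unitary_mat_def)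
  \<comment> \<open>\<open>K\<close> takes coordinates in the eigenbasis for \<open>P * X\<close>,
    applies the adjoint of \<open>P\<close>, and returns coordinates in the eigenbasis for
    \<open>X\<close>. The \<open>k\<close> equations for \<open>c\<close> make the first
    \<open>k\<close> of these vanish.\<close>
  define K where "K = mat_adjoint W * (mat_adjoint P * W')"
  have Kc: "K \<in> carrier_mat m m" using Wc P by (simp add: K_def mult_carrier_mat[of _ m m])
  obtain c where c: "\<exists>i\<le>k. c i \<noteq> 0" "\<And>j. j < k \<Longrightarrow> (\<Sum>i\<le>k. K $$ (j, i) * c i) = 0"
    by (rule homogeneous_system_nontrivial[of k "\<lambda>j i. K $$ (j, i)"]) blast
  define v where "v = mat m 1 (\<lambda>(i, _). if i \<le> k then c i else 0)"
  note v = truncated_column[OF k c(1), folded v_def]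
  define z where "z = mat_adjoint P * (W' * v)"
  define e where "e = mat_adjoint W * z"
  have zc: "z \<in> carrier_mat m 1" and ec: "e \<in> carrier_mat m 1"
    using Wc P v(1) by (auto simp: z_def e_def mult_carrier_mat[of _ m m])
  have "e = K * v"
    unfolding e_def z_def K_def using Wc P v(1)
    by (simp add: assoc_mult_mat[of _ m m _ m _ 1] mult_carrier_mat[of _ m m])
  hence e0: "e $$ (j, 0) = 0" if "j < k" for j
    using v(3)[OF Kc, of j] c(2)[OF that] that k by simp
  \<comment> \<open>Both quadratic forms are the squared norm of the same vector, the adjoint of
    \<open>X\<close> applied to \<open>z\<close>.\<close>
  have "mat_adjoint Y' * v = mat_adjoint X * z"
    unfolding XY'(1) z_def using Wc P X v(1)
    by (simp add: mat_adjoint_mult[of _ m m _ n] assoc_mult_mat[of _ n m _ m _ m]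
        assoc_mult_mat[of _ n m _ m _ 1] assoc_mult_mat[of _ m m _ m _ 1] mult_carrier_mat[of _ m m] mult_carrier_mat[of _ n m])
  moreover have "mat_adjoint Y * e = mat_adjoint X * z"
  proof -
    have "mat_adjoint Y * e = mat_adjoint X * W * (mat_adjoint W * z)"
      unfolding XY(1) e_def using Wc X by (simp add: mat_adjoint_mult[of _ m m _ n])
    also have "\<dots> = mat_adjoint X * (W * (mat_adjoint W * z))"
      by (rule assoc_mult_mat) (use Wc X zc in auto)
    also have "W * (mat_adjoint W * z) = W * mat_adjoint W * z"
      by (rule assoc_mult_mat[symmetric]) (use Wc zc in auto)
    also have "\<dots> = z" using unitary_mat_right[OF W] zc by simp
    finally show ?thesis .
  qed
  ultimately have eq: "frob_sq (mat_adjoint Y' * v) = frob_sq (mat_adjoint Y * e)" by simp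
  have "gram_eigs (P * X) ! k * frob_sq v \<le> frob_sq (mat_adjoint Y' * v)"
    unfolding frob_sq_diagonal_gram[OF Y' D' v(1)]
    by (rule v(4)) (use gram_eigs_antimono[OF PX] k in auto)
  also have "\<dots> = (\<Sum>i<m. gram_eigs X ! i * (cmod (e $$ (i, 0)))\<^sup>2)"
    unfolding eq by (rule frob_sq_diagonal_gram[OF Y D ec])
  \<comment> \<open>Coordinates below \<open>k\<close> vanish, and from \<open>k\<close> on the
    eigenvalues are at most the one at \<open>k\<close>.\<close>
  also have "\<dots> \<le> (\<Sum>i<m. gram_eigs X ! k * (cmod (e $$ (i, 0)))\<^sup>2)"
  proof (rule sum_mono)
    fix i assume i: "i \<in> {..<m}"
    show "gram_eigs X ! i * (cmod (e $$ (i, 0)))\<^sup>2 \<le> gram_eigs X ! k * (cmod (e $$ (i, 0)))\<^sup>2"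
    proof (cases "i < k")
      case False
      thus ?thesis using gram_eigs_antimono[OF X, of k i] i by (intro mult_right_mono) auto
    qed (use e0 in auto)
  qed
  also have "\<dots> = gram_eigs X ! k * frob_sq e"
    by (simp add: frob_sq_carrier[OF ec] sum_distrib_left)
  also have "frob_sq e = frob_sq z"
    unfolding e_def by (rule frob_sq_isometry[of _ m m]) (use Wc zc unitary_mat_right[OF W] in auto)
  also have "gram_eigs X ! k * frob_sq z \<le> gram_eigs X ! k * frob_sq (W' * v)"
    unfolding z_def by (intro mult_left_mono contr gram_eigs_nonneg[OF X k]) (use Wc v in auto)
  also have "frob_sq (W' * v) = frob_sq v"
    by (rule frob_sq_isometry[of _ m m]) (use W' Wc v(1) in \<open>auto simp: unitary_mat_def\<close>)
  finally show ?thesis using v(2) by simp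
qed

subsection \<open>Realignment\<close>

lemma sum_pair_index:
  fixes f :: "nat \<Rightarrow> 'a :: comm_monoid_add"
  shows "(\<Sum>k<m * n. f k) = (\<Sum>i<m. \<Sum>j<n. f (i * n + j))"
proof -
  have "(\<Sum>k<m * n. f k) = (\<Sum>i<m. sum f {i * n..<i * n + n})"
    by (rule sum.nat_group[symmetric])
  also have "\<dots> = (\<Sum>i<m. \<Sum>j<n. f (i * n + j))"
  proof (rule sum.cong[OF refl])
    fix i show "sum f {i * n..<i * n + n} = (\<Sum>j<n. f (i * n + j))"
      using sum.shift_bounds_nat_ivl[of f 0 "i * n" n] by (simp add: atLeast0LessThan add.commute)
  qed
  finally show ?thesis .
qed

lemma pair_index_less:
  assumes "i < m" "j < n"
  shows "i * n + j < m * (n::nat)"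
proof -
  have "i * n + j < Suc i * n" using assms by simp
  also have "\<dots> \<le> m * n" using assms by (intro mult_right_mono) auto
  finally show ?thesis .
qed

lemma pair_index_div_mod:
  assumes "(k::nat) < m * n"
  shows "k div n < m" "k mod n < n" "k div n * n + k mod n = k"
proof -
  have "n \<noteq> 0" using assms by (cases n) auto
  thus "k div n < m" "k mod n < n" "k div n * n + k mod n = k"
    using assms by (simp_all add: less_mult_imp_div_less)
qed

lemma hermitian_matD:
  assumes "hermitian_mat n X"
  shows "X \<in> carrier_mat n n" "i < n \<Longrightarrow> j < n \<Longrightarrow> cnj (X $$ (i, j)) = X $$ (j, i)"
proof -
  show c: "X \<in> carrier_mat n n" using assms by (simp add: hermitian_mat_def)
  show "cnj (X $$ (i, j)) = X $$ (j, i)" if "i < n" "j < n"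
    using assms c that mat_adjoint_index[of j X i] by (auto simp: hermitian_mat_def)
qed

lemma hermitian_matI:
  assumes c: "X \<in> carrier_mat n n" and "\<And>i j. i < n \<Longrightarrow> j < n \<Longrightarrow> cnj (X $$ (i, j)) = X $$ (j, i)"
  shows "hermitian_mat n X"
  unfolding hermitian_mat_def using assms by auto

lemma kron_index:
  assumes "X \<in> carrier_mat m m'" "Y \<in> carrier_mat n n'" "a < m" "b < n" "c < m'" "d < n'"
  shows "kron X Y $$ (a * n + b, c * n' + d) = X $$ (a, c) * Y $$ (b, d)"
  using assms pair_index_less[of a m b n] pair_index_less[of c m' d n'] by (auto simp: kron_def)

lemma kron_carrier [simp]:
  "X \<in> carrier_mat m m' \<Longrightarrow> Y \<in> carrier_mat n n' \<Longrightarrow> kron X Y \<in> carrier_mat (m * n) (m' * n')"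
  by (auto simp: kron_def)

lemma eq_mat_pair_index:
  assumes "X \<in> carrier_mat (m * n) (m' * n')" "Y \<in> carrier_mat (m * n) (m' * n')"
    and "\<And>a b c d. a < m \<Longrightarrow> b < n \<Longrightarrow> c < m' \<Longrightarrow> d < n' \<Longrightarrow>
      X $$ (a * n + b, c * n' + d) = Y $$ (a * n + b, c * n' + d)"
  shows "X = Y"
proof (rule eq_matI)
  fix i j assume "i < dim_row Y" "j < dim_col Y"
  hence "i < m * n" "j < m' * n'" using assms by auto
  note pair_index_div_mod[OF this(1)] pair_index_div_mod[OF this(2)]
  thus "X $$ (i, j) = Y $$ (i, j)" using assms(3)[of "i div n" "i mod n" "j div n'" "j mod n'"] by simp
qed (use assms in auto)

text \<open>The two A indices form the row index and the two B indices the column index, so product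
  operators become matrices of rank one.\<close>

definition realign :: "nat \<Rightarrow> nat \<Rightarrow> complex mat \<Rightarrow> complex mat" where
  "realign dA dB \<rho> = mat (dA * dA) (dB * dB)
     (\<lambda>(i, j). \<rho> $$ (i div dA * dB + j div dB, i mod dA * dB + j mod dB))"

lemma realign_carrier [simp]: "realign dA dB \<rho> \<in> carrier_mat (dA * dA) (dB * dB)"
  by (simp add: realign_def)

lemma realign_index:
  assumes "a < dA" "a' < dA" "b < dB" "b' < dB"
  shows "realign dA dB \<rho> $$ (a * dA + a', b * dB + b') = \<rho> $$ (a * dB + b, a' * dB + b')"
  using assms pair_index_less[of a dA a' dA] pair_index_less[of b dB b' dB]
  by (simp add: realign_def)

lemma frob_sq_realign:
  assumes "\<rho> \<in> carrier_mat (dA * dB) (dA * dB)"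
  shows "frob_sq (realign dA dB \<rho>) = frob_sq \<rho>"
proof -
  have "frob_sq (realign dA dB \<rho>) = (\<Sum>a<dA. \<Sum>a'<dA. \<Sum>b<dB. \<Sum>b'<dB. (cmod (\<rho> $$ (a * dB + b, a' * dB + b')))\<^sup>2)"
    unfolding frob_sq_carrier[OF realign_carrier] sum_pair_index by (simp add: realign_index)
  also have "\<dots> = (\<Sum>a<dA. \<Sum>b<dB. \<Sum>a'<dA. \<Sum>b'<dB. (cmod (\<rho> $$ (a * dB + b, a' * dB + b')))\<^sup>2)"
    by (intro sum.cong refl sum.swap)
  also have "\<dots> = frob_sq \<rho>"
    unfolding frob_sq_carrier[OF assms] sum_pair_index ..
  finally show ?thesis .
qed

lemma realign_minus:
  assumes "\<rho> \<in> carrier_mat (dA * dB) (dA * dB)" "\<chi> \<in> carrier_mat (dA * dB) (dA * dB)"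
  shows "realign dA dB (\<rho> - \<chi>) = realign dA dB \<rho> - realign dA dB \<chi>"
proof (rule eq_mat_pair_index[of _ dA dA dB dB])
  fix a b c d assume *: "a < dA" "b < dA" "c < dB" "d < dB"
  show "realign dA dB (\<rho> - \<chi>) $$ (a * dA + b, c * dB + d)
      = (realign dA dB \<rho> - realign dA dB \<chi>) $$ (a * dA + b, c * dB + d)"
    using * assms pair_index_less[of a dA c dB] pair_index_less[of b dA d dB]
      pair_index_less[of a dA b dA] pair_index_less[of c dB d dB]
    by (subst index_minus_mat) (auto simp: realign_index realign_def)
qed (auto simp: realign_def)

lemma realign_inj:
  assumes c: "\<rho> \<in> carrier_mat (dA * dB) (dA * dB)" "\<chi> \<in> carrier_mat (dA * dB) (dA * dB)"
    and eq: "realign dA dB \<rho> = realign dA dB \<chi>"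
  shows "\<rho> = \<chi>"
  by (rule eq_mat_pair_index[OF c])
     (metis eq realign_index)

section \<open>The correlation matrix as a change of basis\<close>

definition basis_mat :: "nat \<Rightarrow> (nat \<Rightarrow> complex mat) \<Rightarrow> complex mat" where
  "basis_mat n A = mat (n * n) (n * n) (\<lambda>(k, i). A i $$ (k div n, k mod n))"

lemma basis_mat_index:
  assumes "a < n" "a' < n" "i < n * n"
  shows "basis_mat n A $$ (a * n + a', i) = A i $$ (a, a')"
  using assms pair_index_less[of a n a' n] by (simp add: basis_mat_def)

text \<open>The columns are the vectorised basis operators; their inner products are the traces
  tr(XY), since Hermiticity removes the adjoint.\<close>

lemma basis_mat_unitary:
  assumes "herm_onb n A"
  shows "unitary_mat (n * n) (basis_mat n A)"
proof -
  have c: "basis_mat n A \<in> carrier_mat (n * n) (n * n)" by (simp add: basis_mat_def)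
  have "mat_adjoint (basis_mat n A) * basis_mat n A = 1\<^sub>m (n * n)"
  proof (rule eq_matI)
    fix i j assume "i < dim_row (1\<^sub>m (n * n))" "j < dim_col (1\<^sub>m (n * n))"
    hence ij: "i < n * n" "j < n * n" by auto
    have hA: "hermitian_mat n (A i)" "hermitian_mat n (A j)" and o: "mtrace (A i * A j) = (if i = j then 1 else 0)"
      using assms ij by (auto simp: herm_onb_def power2_eq_square)
    note hc = hermitian_matD(1)[OF hA(1)] hermitian_matD(1)[OF hA(2)]
    have "(mat_adjoint (basis_mat n A) * basis_mat n A) $$ (i, j)
       = (\<Sum>k<n * n. cnj (basis_mat n A $$ (k, i)) * basis_mat n A $$ (k, j))"
      using ij c by (subst mult_mat_index[of _ "n * n" "n * n" _ "n * n"]) auto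
    also have "\<dots> = (\<Sum>a<n. \<Sum>a'<n. cnj (A i $$ (a, a')) * A j $$ (a, a'))"
      unfolding sum_pair_index using ij by (simp add: basis_mat_index)
    also have "\<dots> = mtrace (mat_adjoint (A i) * A j)"
      by (rule mtrace_adjoint_mult[symmetric]) (use hc in auto)
    also have "\<dots> = mtrace (A i * A j)" using hA(1) by (simp add: hermitian_mat_def)
    finally show "(mat_adjoint (basis_mat n A) * basis_mat n A) $$ (i, j) = 1\<^sub>m (n * n) $$ (i, j)"
      using o ij by simp
  qed (auto simp: basis_mat_def)
  thus ?thesis using c by (simp add: unitary_mat_def)
qed

lemma mtrace_mult:
  assumes "X \<in> carrier_mat m n" "Y \<in> carrier_mat n m"
  shows "mtrace (X * Y) = (\<Sum>i<m. \<Sum>j<n. X $$ (i, j) * Y $$ (j, i))"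
  using assms by (simp add: mtrace_def mult_mat_index[of _ m n _ m])

text \<open>The trace formula pairs the realigned index \<open>(b, b')\<close> with the entry
  \<open>(b', b)\<close> of \<open>B j\<close>; transposing the B basis turns this into a column of
  \<open>basis_mat\<close>.\<close>

lemma herm_onb_transpose:
  assumes "herm_onb n B"
  shows "herm_onb n (\<lambda>j. transpose_mat (B j))"
proof -
  have h: "hermitian_mat n (B j)" if "j < n\<^sup>2" for j using assms that by (simp add: herm_onb_def)
  have "hermitian_mat n (transpose_mat (B j))" if "j < n\<^sup>2" for j
    by (rule hermitian_matI) (use hermitian_matD[OF h[OF that]] in auto)
  moreover have "mtrace (transpose_mat (B i) * transpose_mat (B j)) = mtrace (B i * B j)"
    if ij: "i < n\<^sup>2" "j < n\<^sup>2" for i j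
  proof -
    note c = hermitian_matD(1)[OF h[OF ij(1)]] hermitian_matD(1)[OF h[OF ij(2)]]
    have "mtrace (transpose_mat (B i) * transpose_mat (B j)) = (\<Sum>a<n. \<Sum>b<n. B i $$ (b, a) * B j $$ (a, b))"
      using c by (subst mtrace_mult[of _ n n]) auto
    also have "\<dots> = mtrace (B i * B j)"
      using c by (subst sum.swap) (simp add: mtrace_mult[of _ n n])
    finally show ?thesis .
  qed
  ultimately show ?thesis using assms by (simp add: herm_onb_def)
qed

lemma mtrace_mult_kron:
  assumes s: "\<sigma> \<in> carrier_mat (dA * dB) (dA * dB)" and X: "X \<in> carrier_mat dA dA" and Y: "Y \<in> carrier_mat dB dB"
  shows "mtrace (\<sigma> * kron X Y) =
    (\<Sum>a<dA. \<Sum>a'<dA. \<Sum>b<dB. \<Sum>b'<dB. \<sigma> $$ (a * dB + b, a' * dB + b') * (X $$ (a', a) * Y $$ (b', b)))"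
proof -
  have "mtrace (\<sigma> * kron X Y) = (\<Sum>a<dA. \<Sum>b<dB. \<Sum>a'<dA. \<Sum>b'<dB.
      \<sigma> $$ (a * dB + b, a' * dB + b') * (X $$ (a', a) * Y $$ (b', b)))"
    unfolding mtrace_mult[OF s kron_carrier[OF X Y]] sum_pair_index
    using X Y by (simp add: kron_index[OF X Y])
  also have "\<dots> = (\<Sum>a<dA. \<Sum>a'<dA. \<Sum>b<dB. \<Sum>b'<dB.
      \<sigma> $$ (a * dB + b, a' * dB + b') * (X $$ (a', a) * Y $$ (b', b)))"
    by (intro sum.cong refl sum.swap)
  finally show ?thesis .
qed

lemma hermitian_kron:
  assumes "hermitian_mat m X" "hermitian_mat n Y"
  shows "hermitian_mat (m * n) (kron X Y)"
proof (rule hermitian_matI)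
  note c = hermitian_matD(1)[OF assms(1)] hermitian_matD(1)[OF assms(2)]
  show "kron X Y \<in> carrier_mat (m * n) (m * n)" using c by simp
  fix i j assume ij: "i < m * n" "j < m * n"
  note d = pair_index_div_mod[OF ij(1)] pair_index_div_mod[OF ij(2)]
  show "cnj (kron X Y $$ (i, j)) = kron X Y $$ (j, i)"
    using kron_index[OF c d(1,2,4,5)] kron_index[OF c d(4,5,1,2)] d
      hermitian_matD(2)[OF assms(1), of "i div n" "j div n"] hermitian_matD(2)[OF assms(2), of "i mod n" "j mod n"]
    by simp
qed

text \<open>The trace equals its own conjugate, so the entries of \<open>corr_mat\<close> are the
  full traces.\<close>

lemma mtrace_hermitian_mult_real:
  assumes X: "hermitian_mat n X" and Y: "hermitian_mat n Y"
  shows "complex_of_real (Re (mtrace (X * Y))) = mtrace (X * Y)"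
proof -
  have "cnj (mtrace (X * Y)) = (\<Sum>i<n. \<Sum>j<n. X $$ (j, i) * Y $$ (i, j))"
    using hermitian_matD[OF X] hermitian_matD[OF Y] by (simp add: mtrace_mult[of _ n n])
  also have "\<dots> = mtrace (X * Y)"
    using hermitian_matD[OF X] hermitian_matD[OF Y] by (subst sum.swap) (simp add: mtrace_mult[of _ n n])
  finally show ?thesis by (simp add: complex_eq_iff)
qed

text \<open>On the A side, conjugating the Hermitian \<open>A i\<close> supplies the index exchange
  made by the trace, so an adjoint of \<open>basis_mat\<close> appears; on the B side there is no
  conjugate and the transposes supply it.\<close>

lemma corr_mat_eq_realign:
  assumes A: "herm_onb dA A" and B: "herm_onb dB B" and s: "hermitian_mat (dA * dB) \<sigma>"
  shows "map_mat complex_of_real (corr_mat dA dB A B \<sigma>)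
    = mat_adjoint (basis_mat dA A) * realign dA dB \<sigma> * basis_mat dB (\<lambda>j. transpose_mat (B j))"
    (is "?C = mat_adjoint ?U * ?R * ?V")
proof (rule eq_matI)
  have c: "?U \<in> carrier_mat (dA * dA) (dA * dA)" "?V \<in> carrier_mat (dB * dB) (dB * dB)"
    by (auto simp: basis_mat_def)
  note R = realign_carrier[of dA dB \<sigma>]
  have UR: "mat_adjoint ?U * ?R \<in> carrier_mat (dA * dA) (dB * dB)"
    using c by (intro mult_carrier_mat[OF _ R]) auto
  fix i j assume "i < dim_row (mat_adjoint ?U * ?R * ?V)" "j < dim_col (mat_adjoint ?U * ?R * ?V)"
  hence ij: "i < dA * dA" "j < dB * dB" using c by auto
  have h: "hermitian_mat dA (A i)" "hermitian_mat dB (B j)"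
    using A B ij by (auto simp: herm_onb_def power2_eq_square)
  note hc = hermitian_matD(1)[OF h(1)] hermitian_matD(1)[OF h(2)]
  have "?C $$ (i, j) = mtrace (\<sigma> * kron (A i) (B j))"
    using ij mtrace_hermitian_mult_real[OF s hermitian_kron[OF h]]
    by (simp add: corr_mat_def power2_eq_square)
  also have "\<dots> = (\<Sum>a<dA. \<Sum>a'<dA. \<Sum>b<dB. \<Sum>b'<dB.
      \<sigma> $$ (a * dB + b, a' * dB + b') * (A i $$ (a', a) * B j $$ (b', b)))"
    using hermitian_matD(1)[OF s] hc by (rule mtrace_mult_kron)
  also have "\<dots> = (\<Sum>k<dA * dA. \<Sum>l<dB * dB. cnj (?U $$ (k, i)) * ?R $$ (k, l) * ?V $$ (l, j))"
    unfolding sum_pair_index using ij hc hermitian_matD(2)[OF h(1)]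
    by (simp add: basis_mat_index realign_index mult_ac)
  also have "\<dots> = (\<Sum>l<dB * dB. \<Sum>k<dA * dA. cnj (?U $$ (k, i)) * ?R $$ (k, l) * ?V $$ (l, j))"
    by (rule sum.swap)
  also have "\<dots> = (\<Sum>l<dB * dB. (mat_adjoint ?U * ?R) $$ (i, l) * ?V $$ (l, j))"
    using c ij by (simp add: mult_mat_index[OF _ R, of _ "dA * dA"] sum_distrib_right)
  also have "\<dots> = (mat_adjoint ?U * ?R * ?V) $$ (i, j)"
    using ij by (simp add: mult_mat_index[OF UR c(2)])
  finally show "?C $$ (i, j) = (mat_adjoint ?U * ?R * ?V) $$ (i, j)" .
qed (auto simp: corr_mat_def basis_mat_def power2_eq_square)

text \<open>The right unitary cancels in \<open>Z * mat_adjoint Z\<close>, and the left one acts by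
  similarity.\<close>

lemma char_poly_gram_unitary:
  assumes U: "unitary_mat m U" and V: "unitary_mat n V" and X: "X \<in> carrier_mat m n"
  defines "Z \<equiv> mat_adjoint U * X * V"
  shows "char_poly (Z * mat_adjoint Z) = char_poly (X * mat_adjoint X)"
proof -
  have c: "U \<in> carrier_mat m m" "V \<in> carrier_mat n n" using U V by (auto simp: unitary_mat_def)
  have UX: "mat_adjoint U * X \<in> carrier_mat m n" using c X by (auto intro!: mult_carrier_mat[of _ m m])
  have UX': "mat_adjoint (mat_adjoint U * X) \<in> carrier_mat n m" using UX by simp
  have Zc: "Z \<in> carrier_mat m n" using UX c by (simp add: Z_def)
  have "Z * mat_adjoint Z = mat_adjoint U * X * V * (mat_adjoint V * mat_adjoint (mat_adjoint U * X))"
    unfolding Z_def by (subst mat_adjoint_mult[OF UX c(2)]) simp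
  also have "\<dots> = mat_adjoint U * X * (V * (mat_adjoint V * mat_adjoint (mat_adjoint U * X)))"
    by (rule assoc_mult_mat[OF UX c(2) mult_carrier_mat[OF _ UX']]) (use c in auto)
  also have "V * (mat_adjoint V * mat_adjoint (mat_adjoint U * X)) = V * mat_adjoint V * mat_adjoint (mat_adjoint U * X)"
    by (rule assoc_mult_mat[OF c(2) _ UX', symmetric]) (use c in auto)
  also have "\<dots> = mat_adjoint X * U"
    using unitary_mat_right[OF V] c X UX by (simp add: mat_adjoint_mult[of _ m m _ n])
  also have "mat_adjoint U * X * (mat_adjoint X * U) = mat_adjoint U * X * mat_adjoint X * U"
    by (rule assoc_mult_mat[OF UX, symmetric]) (use c X in auto)
  also have "mat_adjoint U * X * mat_adjoint X = mat_adjoint U * (X * mat_adjoint X)"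
    by (rule assoc_mult_mat) (use c X in auto)
  finally have "Z * mat_adjoint Z = mat_adjoint U * (X * mat_adjoint X) * U" .
  hence "similar_mat_wit (Z * mat_adjoint Z) (X * mat_adjoint X) (mat_adjoint U) U"
    using c X Zc U unitary_mat_right[OF U]
    by (intro similar_mat_witI[of _ _ m]) (auto simp: unitary_mat_def)
  thus ?thesis using char_poly_similar unfolding similar_mat_def by blast
qed

text \<open>The complex factorisation descends to the real polynomial because the embedding of
  polynomials is injective. As \<open>sqrt\<close> is monotone, sorting keeps the order of
  \<open>gram_eigs X\<close>.\<close>

lemma sing_vals_eq_gram_eigs:
  assumes C: "C \<in> carrier_mat m n" and X: "X \<in> carrier_mat m n"
    and cp: "char_poly (map_mat complex_of_real C * mat_adjoint (map_mat complex_of_real C))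
        = char_poly (X * mat_adjoint X)"
  shows "sing_vals C = map sqrt (take (min m n) (gram_eigs X))"
proof -
  interpret hom: map_poly_inj_idom_hom complex_of_real ..
  have adj: "mat_adjoint (map_mat complex_of_real C) = map_mat complex_of_real (transpose_mat C)"
    by (rule eq_matI) auto
  have CT: "C * transpose_mat C \<in> carrier_mat m m" using C by simp
  have "map_poly complex_of_real (char_poly (C * transpose_mat C))
      = char_poly (map_mat complex_of_real (C * transpose_mat C))"
    by (rule of_real_hom.char_poly_hom[OF CT, symmetric])
  also have "map_mat complex_of_real (C * transpose_mat C)
      = map_mat complex_of_real C * mat_adjoint (map_mat complex_of_real C)"
    unfolding adj using C by (intro of_real_hom.mat_hom_mult[of _ m n _ m]) auto
  also have "char_poly \<dots> = (\<Prod>e\<leftarrow>gram_eigs X. [:- complex_of_real e, 1:])"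
    unfolding cp gram_eigs_def by (rule char_poly_herm_eigs[OF gram_hermitian[OF X]])
  also have "\<dots> = map_poly complex_of_real (\<Prod>e\<leftarrow>gram_eigs X. [:- e, 1:])"
    by (simp add: hom.hom_prod_list comp_def)
  finally have "char_poly (C * transpose_mat C) = (\<Prod>e\<leftarrow>gram_eigs X. [:- e, 1:])"
    by (simp only: hom.eq_iff)
  hence pr: "proots (char_poly (C * transpose_mat C)) = mset (gram_eigs X)"
    by (simp add: proots_prod_linear)
  have "sorted (rev (map sqrt (gram_eigs X)))"
    unfolding sorted_rev_iff_nth_mono using gram_eigs_antimono[OF X] length_gram_eigs[OF X] by auto
  hence "sorted_list_of_multiset (mset (map sqrt (gram_eigs X))) = rev (map sqrt (gram_eigs X))"
    by (metis mset_rev sorted_list_of_multiset_mset sorted_sort_id)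
  thus ?thesis using C unfolding sing_vals_def pr by (simp add: take_map)
qed

lemma sing_vals_corr_mat:
  assumes "herm_onb dA A" "herm_onb dB B" "hermitian_mat (dA * dB) \<sigma>"
  shows "sing_vals (corr_mat dA dB A B \<sigma>)
    = map sqrt (take ((min dA dB)\<^sup>2) (gram_eigs (realign dA dB \<sigma>)))"
proof -
  have "min (dA * dA) (dB * dB) = (min dA dB)\<^sup>2"
    using mult_le_mono[of dA dB dA dB] mult_le_mono[of dB dA dB dA]
    by (cases "dA \<le> dB") (simp_all add: min_absorb1 min_absorb2 power2_eq_square)
  moreover have "sing_vals (corr_mat dA dB A B \<sigma>)
    = map sqrt (take (min (dA * dA) (dB * dB)) (gram_eigs (realign dA dB \<sigma>)))"
  proof (rule sing_vals_eq_gram_eigs)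
    show "corr_mat dA dB A B \<sigma> \<in> carrier_mat (dA * dA) (dB * dB)"
      by (simp add: corr_mat_def power2_eq_square)
  qed (auto simp: corr_mat_eq_realign[OF assms] intro!: char_poly_gram_unitary
        basis_mat_unitary[OF assms(1)] basis_mat_unitary[OF herm_onb_transpose[OF assms(2)]])
  ultimately show ?thesis by simp
qed

subsection \<open>Local measurements\<close>

lemma onb_vecs_orthonormal:
  assumes "onb_vecs n u" "l < n" "k < n"
  shows "(\<Sum>a<n. cnj (u l $ a) * u k $ a) = (if l = k then 1 else 0)"
proof -
  have "u l \<in> carrier_vec n" "u k \<in> carrier_vec n" "conjugate (u l) \<bullet> u k = (if l = k then 1 else 0)"
    using assms by (auto simp: onb_vecs_def)
  thus ?thesis by (simp add: scalar_prod_def atLeast0LessThan)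
qed

text \<open>The square matrix with columns \<open>u l\<close> is unitary, so its rows are
  orthonormal too.\<close>

lemma onb_vecs_complete:
  assumes u: "onb_vecs n u" and ac: "a < n" "c < n"
  shows "(\<Sum>l<n. u l $ a * cnj (u l $ c)) = (if a = c then 1 else 0)"
proof -
  define W where "W = mat n n (\<lambda>(a, l). u l $ a)"
  have Wc: "W \<in> carrier_mat n n" by (simp add: W_def)
  have "mat_adjoint W * W = 1\<^sub>m n"
    by (rule eq_matI) (use Wc in \<open>auto simp: mult_mat_index[of _ n n _ n] W_def onb_vecs_orthonormal[OF u]\<close>)
  hence "W * mat_adjoint W = 1\<^sub>m n" using Wc by (intro unitary_mat_right) (simp add: unitary_mat_def)
  moreover have "(W * mat_adjoint W) $$ (a, c) = (\<Sum>l<n. u l $ a * cnj (u l $ c))"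
    using ac by (subst mult_mat_index[of _ n n _ n]) (auto simp: W_def)
  ultimately show ?thesis using ac by simp
qed

lemma onb_vecs_col_unitary:
  assumes W: "unitary_mat n W"
  shows "onb_vecs n (col W)"
proof -
  have Wc: "W \<in> carrier_mat n n" and u: "mat_adjoint W * W = 1\<^sub>m n"
    using W by (auto simp: unitary_mat_def)
  have "conjugate (col W l) \<bullet> col W k = (if l = k then 1 else 0)" if "l < n" "k < n" for l k
  proof -
    have "conjugate (col W l) \<bullet> col W k = (mat_adjoint W * W) $$ (l, k)"
      using that Wc by (simp add: mult_mat_index[of _ n n _ n] scalar_prod_def atLeast0LessThan)
    thus ?thesis unfolding u using that by simp
  qed
  thus ?thesis using Wc by (auto simp: onb_vecs_def)
qed

text \<open>Column \<open>l\<close> is the vectorised projector \<open>proj (u l)\<close>.\<close>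

definition meas_mat :: "nat \<Rightarrow> (nat \<Rightarrow> complex vec) \<Rightarrow> complex mat" where
  "meas_mat n u = mat (n * n) n (\<lambda>(k, l). u l $ (k div n) * cnj (u l $ (k mod n)))"

lemma meas_mat_carrier [simp]: "meas_mat n u \<in> carrier_mat (n * n) n"
  by (simp add: meas_mat_def)

lemma meas_mat_index:
  "a < n \<Longrightarrow> a' < n \<Longrightarrow> l < n \<Longrightarrow> meas_mat n u $$ (a * n + a', l) = u l $ a * cnj (u l $ a')"
  using pair_index_less[of a n a' n] by (simp add: meas_mat_def)

text \<open>The inner product of two columns factors as the squared modulus of the inner product of
  \<open>u l\<close> and \<open>u k\<close>.\<close>

lemma meas_mat_isometry:
  assumes u: "onb_vecs n u"
  shows "mat_adjoint (meas_mat n u) * meas_mat n u = 1\<^sub>m n"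
proof (rule eq_matI)
  fix l k assume "l < dim_row (1\<^sub>m n)" "k < dim_col (1\<^sub>m n)"
  hence lk: "l < n" "k < n" by auto
  have Q: "dim_row (meas_mat n u) = n * n" "dim_col (meas_mat n u) = n" by (auto simp: meas_mat_def)
  have "(mat_adjoint (meas_mat n u) * meas_mat n u) $$ (l, k)
      = (\<Sum>i<n * n. cnj (meas_mat n u $$ (i, l)) * meas_mat n u $$ (i, k))"
    using lk by (subst mult_mat_index[of _ n "n * n" _ n]) (auto simp: Q)
  also have "\<dots> = (\<Sum>a<n. \<Sum>a'<n. (cnj (u l $ a) * u k $ a) * cnj (cnj (u l $ a') * u k $ a'))"
    unfolding sum_pair_index using lk by (simp add: meas_mat_index mult_ac)
  also have "\<dots> = (\<Sum>a<n. cnj (u l $ a) * u k $ a) * cnj (\<Sum>a'<n. cnj (u l $ a') * u k $ a')"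
    by (simp only: sum_product cnj_sum)
  finally show "(mat_adjoint (meas_mat n u) * meas_mat n u) $$ (l, k) = 1\<^sub>m n $$ (l, k)"
    using lk by (simp add: onb_vecs_orthonormal[OF u])
qed (auto simp: meas_mat_def)

text \<open>The partial matrix element of \<open>\<rho>\<close> at \<open>u l\<close>: the
  unnormalised state of B after outcome \<open>l\<close>.\<close>

definition cond_mat :: "nat \<Rightarrow> nat \<Rightarrow> (nat \<Rightarrow> complex vec) \<Rightarrow> complex mat \<Rightarrow> nat \<Rightarrow> complex mat" where
  "cond_mat dA dB u \<rho> l = mat dB dB (\<lambda>(b, b'). \<Sum>c<dA. \<Sum>c'<dA.
     cnj (u l $ c) * \<rho> $$ (c * dB + b, c' * dB + b') * u l $ c')"

lemma kron_one_mult_left: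
  assumes X: "X \<in> carrier_mat m m" and M: "M \<in> carrier_mat (m * n) k" and a: "a < m" "b < n" "s < k"
  shows "(kron X (1\<^sub>m n) * M) $$ (a * n + b, s) = (\<Sum>c<m. X $$ (a, c) * M $$ (c * n + b, s))"
proof -
  have "(kron X (1\<^sub>m n) * M) $$ (a * n + b, s)
      = (\<Sum>c<m. \<Sum>d<n. X $$ (a, c) * (if b = d then 1 else 0) * M $$ (c * n + d, s))"
    using a pair_index_less[OF a(1,2)]
    by (subst mult_mat_index[OF kron_carrier[OF X one_carrier_mat] M])
       (auto simp: sum_pair_index kron_index[OF X one_carrier_mat])
  also have "\<dots> = (\<Sum>c<m. X $$ (a, c) * M $$ (c * n + b, s))"
    using a by (intro sum.cong refl) (simp add: if_distrib[of "\<lambda>x. _ * x * _"] cong: if_cong)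
  finally show ?thesis .
qed

lemma kron_one_mult_right:
  assumes X: "X \<in> carrier_mat m m" and M: "M \<in> carrier_mat k (m * n)" and a: "a < m" "b < n" "s < k"
  shows "(M * kron X (1\<^sub>m n)) $$ (s, a * n + b) = (\<Sum>c<m. M $$ (s, c * n + b) * X $$ (c, a))"
proof -
  have "(M * kron X (1\<^sub>m n)) $$ (s, a * n + b)
      = (\<Sum>c<m. \<Sum>d<n. M $$ (s, c * n + d) * (X $$ (c, a) * (if d = b then 1 else 0)))"
    using a pair_index_less[OF a(1,2)]
    by (subst mult_mat_index[OF M kron_carrier[OF X one_carrier_mat]])
       (auto simp: sum_pair_index kron_index[OF X one_carrier_mat])
  also have "\<dots> = (\<Sum>c<m. M $$ (s, c * n + b) * X $$ (c, a))"
    using a by (intro sum.cong refl) (simp add: if_distrib[of "\<lambda>x. _ * (_ * x)"] cong: if_cong)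
  finally show ?thesis .
qed

lemma meas_A_carrier [simp]: "meas_A dA dB u \<rho> \<in> carrier_mat (dA * dB) (dA * dB)"
  by (simp add: meas_A_def)

lemma meas_A_index:
  assumes u: "onb_vecs dA u" and r: "\<rho> \<in> carrier_mat (dA * dB) (dA * dB)"
    and a: "a < dA" "b < dB" "a' < dA" "b' < dB"
  shows "meas_A dA dB u \<rho> $$ (a * dB + b, a' * dB + b')
    = (\<Sum>l<dA. u l $ a * cnj (u l $ a') * cond_mat dA dB u \<rho> l $$ (b, b'))"
proof -
  note p = pair_index_less[OF a(1,2)] pair_index_less[OF a(3,4)]
  have "(kron (proj (u l)) (1\<^sub>m dB) * \<rho> * kron (proj (u l)) (1\<^sub>m dB)) $$ (a * dB + b, a' * dB + b')
    = u l $ a * cnj (u l $ a') * cond_mat dA dB u \<rho> l $$ (b, b')" if l: "l < dA" for l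
  proof -
    have ul: "u l \<in> carrier_vec dA" using u l by (simp add: onb_vecs_def)
    hence pc: "proj (u l) \<in> carrier_mat dA dA" by (auto simp: proj_def)
    have pi: "proj (u l) $$ (i, j) = u l $ i * cnj (u l $ j)" if "i < dA" "j < dA" for i j
      using ul that by (auto simp: proj_def)
    have kc: "kron (proj (u l)) (1\<^sub>m dB) * \<rho> \<in> carrier_mat (dA * dB) (dA * dB)"
      using kron_carrier[OF pc one_carrier_mat, of dB] r by (rule mult_carrier_mat)
    have "(kron (proj (u l)) (1\<^sub>m dB) * \<rho> * kron (proj (u l)) (1\<^sub>m dB)) $$ (a * dB + b, a' * dB + b')
      = (\<Sum>c'<dA. (\<Sum>c<dA. proj (u l) $$ (a, c) * \<rho> $$ (c * dB + b, c' * dB + b')) * proj (u l) $$ (c', a'))"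
      using a p by (subst kron_one_mult_right[OF pc kc])
        (auto simp: kron_one_mult_left[OF pc r] pair_index_less intro!: sum.cong)
    also have "\<dots> = (\<Sum>c'<dA. \<Sum>c<dA. u l $ a * cnj (u l $ a') *
        (cnj (u l $ c) * \<rho> $$ (c * dB + b, c' * dB + b') * u l $ c'))"
      using a by (auto simp: pi sum_distrib_left sum_distrib_right mult_ac intro!: sum.cong)
    also have "\<dots> = (\<Sum>c<dA. \<Sum>c'<dA. u l $ a * cnj (u l $ a') *
        (cnj (u l $ c) * \<rho> $$ (c * dB + b, c' * dB + b') * u l $ c'))"
      by (rule sum.swap)
    finally show ?thesis using a by (simp add: cond_mat_def sum_distrib_left)
  qed
  thus ?thesis using p by (simp add: meas_A_def)
qed

text \<open>The adjoint of \<open>meas_mat\<close> extracts the vectorised conditional operators and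
  \<open>meas_mat\<close> puts them back next to the projectors; together they act as an orthogonal
  projection from the left.\<close>

lemma realign_meas_A:
  assumes u: "onb_vecs dA u" and r: "\<rho> \<in> carrier_mat (dA * dB) (dA * dB)"
  shows "realign dA dB (meas_A dA dB u \<rho>)
    = meas_mat dA u * (mat_adjoint (meas_mat dA u) * realign dA dB \<rho>)"
proof (rule eq_mat_pair_index[of _ dA dA dB dB])
  let ?Q = "meas_mat dA u" and ?R = "realign dA dB \<rho>"
  have Q: "?Q \<in> carrier_mat (dA * dA) dA" "mat_adjoint ?Q \<in> carrier_mat dA (dA * dA)" by auto
  have QR: "mat_adjoint ?Q * ?R \<in> carrier_mat dA (dB * dB)"
    using Q(2) realign_carrier by (rule mult_carrier_mat)
  show "?Q * (mat_adjoint ?Q * ?R) \<in> carrier_mat (dA * dA) (dB * dB)"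
    using Q(1) QR by (rule mult_carrier_mat)
  have dQ: "dim_row ?Q = dA * dA" "dim_col ?Q = dA" by (auto simp: meas_mat_def)
  fix a a' b b' assume a: "a < dA" "a' < dA" "b < dB" "b' < dB"
  note p = pair_index_less[OF a(1,2)] pair_index_less[OF a(3,4)]
  have T: "(mat_adjoint ?Q * ?R) $$ (l, b * dB + b') = cond_mat dA dB u \<rho> l $$ (b, b')" if l: "l < dA" for l
  proof -
    have "(mat_adjoint ?Q * ?R) $$ (l, b * dB + b')
        = (\<Sum>k<dA * dA. cnj (?Q $$ (k, l)) * ?R $$ (k, b * dB + b'))"
      using l p by (subst mult_mat_index[OF Q(2) realign_carrier]) (auto simp: dQ)
    thus ?thesis unfolding sum_pair_index
      using l a by (simp add: meas_mat_index realign_index cond_mat_def mult_ac)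
  qed
  show "realign dA dB (meas_A dA dB u \<rho>) $$ (a * dA + a', b * dB + b')
      = (?Q * (mat_adjoint ?Q * ?R)) $$ (a * dA + a', b * dB + b')"
    using a p by (subst mult_mat_index[OF Q(1) QR])
      (auto simp: realign_index meas_A_index[OF u r] meas_mat_index T)
qed simp

lemma cond_mat_hermitian:
  assumes r: "hermitian_mat (dA * dB) \<rho>"
  shows "hermitian_mat dB (cond_mat dA dB u \<rho> l)"
proof (rule hermitian_matI)
  fix b b' assume b: "b < dB" "b' < dB"
  have "cnj (cond_mat dA dB u \<rho> l $$ (b, b'))
      = (\<Sum>c<dA. \<Sum>c'<dA. cnj (u l $ c') * \<rho> $$ (c' * dB + b', c * dB + b) * u l $ c)"
    using b hermitian_matD(2)[OF r] by (simp add: cond_mat_def pair_index_less mult_ac)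
  also have "\<dots> = cond_mat dA dB u \<rho> l $$ (b', b)"
    using b by (subst sum.swap) (simp add: cond_mat_def)
  finally show "cnj (cond_mat dA dB u \<rho> l $$ (b, b')) = cond_mat dA dB u \<rho> l $$ (b', b)" .
qed (simp add: cond_mat_def)

lemma meas_A_hermitian:
  assumes u: "onb_vecs dA u" and r: "hermitian_mat (dA * dB) \<rho>"
  shows "hermitian_mat (dA * dB) (meas_A dA dB u \<rho>)"
proof (rule hermitian_matI)
  fix i j assume ij: "i < dA * dB" "j < dA * dB"
  note d = pair_index_div_mod[OF ij(1)] pair_index_div_mod[OF ij(2)]
  note m = meas_A_index[OF u hermitian_matD(1)[OF r]]
  show "cnj (meas_A dA dB u \<rho> $$ (i, j)) = meas_A dA dB u \<rho> $$ (j, i)"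
    using m[OF d(1,2,4,5)] m[OF d(4,5,1,2)] d hermitian_matD(2)[OF cond_mat_hermitian[OF r]]
    by (simp add: mult_ac)
qed simp

section \<open>Positivity and traces of the conditional operators\<close>

lemma quad_form_expand:
  fixes X :: "complex mat"
  assumes "X \<in> carrier_mat n n" "v \<in> carrier_vec n"
  shows "conjugate v \<bullet> (X *\<^sub>v v) = (\<Sum>i<n. \<Sum>j<n. cnj (v $ i) * X $$ (i, j) * v $ j)"
  using assms by (auto simp: scalar_prod_def mult_mat_vec_def atLeast0LessThan sum_distrib_left mult_ac
      intro!: sum.cong)

lemma psd_matD:
  assumes "psd_mat n X"
  shows "0 \<le> Re (\<Sum>i<n. \<Sum>j<n. cnj (f i) * X $$ (i, j) * f j)"
proof -
  have X: "X \<in> carrier_mat n n" using assms by (simp add: psd_mat_def hermitian_mat_def)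
  have "0 \<le> Re (conjugate (vec n f) \<bullet> (X *\<^sub>v vec n f))"
    using assms by (simp add: psd_mat_def)
  thus ?thesis by (subst (asm) quad_form_expand[OF X]) auto
qed

lemma psd_matI:
  assumes h: "hermitian_mat n X" and q: "\<And>f. 0 \<le> Re (\<Sum>i<n. \<Sum>j<n. cnj (f i) * X $$ (i, j) * f j)"
  shows "psd_mat n X"
  unfolding psd_mat_def
proof (intro conjI ballI h)
  fix v :: "complex vec" assume v: "v \<in> carrier_vec n"
  show "0 \<le> Re (conjugate v \<bullet> (X *\<^sub>v v))"
    unfolding quad_form_expand[OF hermitian_matD(1)[OF h] v] by (rule q)
qed

lemma psd_mat_diag_nonneg:
  assumes "psd_mat n X" "i < n"
  shows "0 \<le> Re (X $$ (i, i))"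
proof -
  have "(\<Sum>a<n. \<Sum>b<n. cnj (if a = i then 1 else 0) * X $$ (a, b) * (if b = i then 1 else 0)) = X $$ (i, i)"
    using assms(2) by (simp add: if_distrib[of "\<lambda>x. _ * x"] if_distrib[of "\<lambda>x. x * _"] if_distrib[of cnj] cong: if_cong)
  thus ?thesis using psd_matD[OF assms(1), of "\<lambda>a. if a = i then 1 else 0"] by simp
qed

lemma psd_mat_trace:
  assumes "psd_mat n X"
  shows "mtrace X = complex_of_real (Re (mtrace X))" "0 \<le> Re (mtrace X)"
proof -
  have h: "hermitian_mat n X" using assms by (simp add: psd_mat_def)
  note hX = hermitian_matD[OF h]
  show "0 \<le> Re (mtrace X)"
    using hX(1) psd_mat_diag_nonneg[OF assms] by (auto simp: mtrace_def intro!: sum_nonneg)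
  have "cnj (mtrace X) = mtrace X" using hX by (auto simp: mtrace_def intro!: sum.cong)
  thus "mtrace X = complex_of_real (Re (mtrace X))" by (simp add: complex_eq_iff)
qed

text \<open>A vanishing diagonal entry forces its row to vanish: otherwise the quadratic form is
  negative at a suitable combination of two basis vectors.\<close>
lemma psd_mat_trace_zero:
  assumes p: "psd_mat n X" and t: "Re (mtrace X) = 0" and ij: "i < n" "j < n"
  shows "X $$ (i, j) = 0"
proof -
  have h: "hermitian_mat n X" using p by (simp add: psd_mat_def)
  note hX = hermitian_matD[OF h]
  have "(\<Sum>k<n. Re (X $$ (k, k))) = 0" using t hX(1) by (simp add: mtrace_def)
  hence "\<forall>k<n. Re (X $$ (k, k)) = 0"
    using psd_mat_diag_nonneg[OF p] by (subst (asm) sum_nonneg_eq_0_iff) auto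
  hence d: "X $$ (k, k) = 0" if "k < n" for k
    using hX(2)[OF that that] that by (simp add: complex_eq_iff)
  show ?thesis
  proof (cases "i = j")
    case False
    \<comment> \<open>The coefficient at \<open>j\<close> makes both cross terms equal to minus the
      squared modulus of the entry \<open>(i, j)\<close>, while the diagonal terms vanish.\<close>
    define f where "f k = (if k = i then 1 else 0) - (if k = j then X $$ (j, i) else 0)" for k
    have f0: "f k = 0" if "k \<noteq> i" "k \<noteq> j" for k using that by (simp add: f_def)
    have sub: "{i, j} \<subseteq> {..<n}" using ij by auto
    have "(\<Sum>a<n. \<Sum>b<n. cnj (f a) * X $$ (a, b) * f b)
        = (\<Sum>a\<in>{i, j}. \<Sum>b\<in>{i, j}. cnj (f a) * X $$ (a, b) * f b)"
      using f0 sub by (intro sum.mono_neutral_cong_right ballI sum.neutral) auto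
    also have "\<dots> = - 2 * (X $$ (i, j) * X $$ (j, i))"
      using False d ij hX(2)[OF ij(2,1)] by (simp add: f_def)
    also have "X $$ (i, j) * X $$ (j, i) = complex_of_real ((cmod (X $$ (i, j)))\<^sup>2)"
      using hX(2)[OF ij] by (simp only: complex_norm_square)
    finally have "Re (\<Sum>a<n. \<Sum>b<n. cnj (f a) * X $$ (a, b) * f b) = - 2 * (cmod (X $$ (i, j)))\<^sup>2"
      by (simp del: of_real_power)
    with psd_matD[OF p, of f] have "(cmod (X $$ (i, j)))\<^sup>2 \<le> 0" by simp
    thus ?thesis by simp
  qed (use d ij in simp)
qed

text \<open>The form at \<open>f\<close> is the form of \<open>\<rho>\<close> at the product vector
  of \<open>u l\<close> and \<open>f\<close>, called \<open>g\<close> in the proof.\<close>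

lemma cond_mat_psd:
  assumes r: "psd_mat (dA * dB) \<rho>"
  shows "psd_mat dB (cond_mat dA dB u \<rho> l)"
proof (rule psd_matI)
  have h: "hermitian_mat (dA * dB) \<rho>" using r by (simp add: psd_mat_def)
  thus "hermitian_mat dB (cond_mat dA dB u \<rho> l)" by (rule cond_mat_hermitian)
  fix f :: "nat \<Rightarrow> complex"
  define g where "g k = u l $ (k div dB) * f (k mod dB)" for k
  have g: "g (c * dB + b) = u l $ c * f b" if "b < dB" for b c using that by (simp add: g_def)
  have "(\<Sum>b<dB. \<Sum>b'<dB. cnj (f b) * cond_mat dA dB u \<rho> l $$ (b, b') * f b')
      = (\<Sum>b<dB. \<Sum>b'<dB. \<Sum>c<dA. \<Sum>c'<dA.
          cnj (g (c * dB + b)) * \<rho> $$ (c * dB + b, c' * dB + b') * g (c' * dB + b'))"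
    by (simp add: cond_mat_def g sum_distrib_left sum_distrib_right mult_ac)
  also have "\<dots> = (\<Sum>b<dB. \<Sum>c<dA. \<Sum>b'<dB. \<Sum>c'<dA.
          cnj (g (c * dB + b)) * \<rho> $$ (c * dB + b, c' * dB + b') * g (c' * dB + b'))"
    by (intro sum.cong refl sum.swap)
  also have "\<dots> = (\<Sum>b<dB. \<Sum>c<dA. \<Sum>c'<dA. \<Sum>b'<dB.
          cnj (g (c * dB + b)) * \<rho> $$ (c * dB + b, c' * dB + b') * g (c' * dB + b'))"
    by (intro sum.cong refl sum.swap)
  also have "\<dots> = (\<Sum>c<dA. \<Sum>b<dB. \<Sum>c'<dA. \<Sum>b'<dB.
          cnj (g (c * dB + b)) * \<rho> $$ (c * dB + b, c' * dB + b') * g (c' * dB + b'))"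
    by (rule sum.swap)
  also have "\<dots> = (\<Sum>i<dA * dB. \<Sum>j<dA * dB. cnj (g i) * \<rho> $$ (i, j) * g j)"
    by (simp add: sum_pair_index)
  finally show "0 \<le> Re (\<Sum>b<dB. \<Sum>b'<dB. cnj (f b) * cond_mat dA dB u \<rho> l $$ (b, b') * f b')"
    using psd_matD[OF r, of g] by simp
qed

text \<open>Completeness of the basis collapses the sum over outcomes to the diagonal A
  indices.\<close>

lemma sum_mtrace_cond_mat:
  assumes u: "onb_vecs dA u" and r: "\<rho> \<in> carrier_mat (dA * dB) (dA * dB)"
  shows "(\<Sum>l<dA. mtrace (cond_mat dA dB u \<rho> l)) = mtrace \<rho>"
proof -
  have "(\<Sum>l<dA. mtrace (cond_mat dA dB u \<rho> l))
      = (\<Sum>l<dA. \<Sum>b<dB. \<Sum>c<dA. \<Sum>c'<dA. \<rho> $$ (c * dB + b, c' * dB + b) * (u l $ c' * cnj (u l $ c)))"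
    by (simp add: mtrace_def cond_mat_def mult_ac)
  also have "\<dots> = (\<Sum>b<dB. \<Sum>l<dA. \<Sum>c<dA. \<Sum>c'<dA. \<rho> $$ (c * dB + b, c' * dB + b) * (u l $ c' * cnj (u l $ c)))"
    by (rule sum.swap)
  also have "\<dots> = (\<Sum>b<dB. \<Sum>c<dA. \<Sum>l<dA. \<Sum>c'<dA. \<rho> $$ (c * dB + b, c' * dB + b) * (u l $ c' * cnj (u l $ c)))"
    by (intro sum.cong refl sum.swap)
  also have "\<dots> = (\<Sum>b<dB. \<Sum>c<dA. \<Sum>c'<dA. \<Sum>l<dA. \<rho> $$ (c * dB + b, c' * dB + b) * (u l $ c' * cnj (u l $ c)))"
    by (intro sum.cong refl sum.swap)
  also have "\<dots> = (\<Sum>b<dB. \<Sum>c<dA. \<rho> $$ (c * dB + b, c * dB + b))"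
    by (simp add: sum_distrib_left[symmetric] onb_vecs_complete[OF u] if_distrib[of "\<lambda>x. _ * x"] cong: if_cong)
  also have "\<dots> = (\<Sum>c<dA. \<Sum>b<dB. \<rho> $$ (c * dB + b, c * dB + b))"
    by (rule sum.swap)
  also have "\<dots> = mtrace \<rho>" using r by (simp add: mtrace_def sum_pair_index)
  finally show ?thesis .
qed

lemma density_mat_normalize:
  assumes p: "psd_mat n X" and t: "Re (mtrace X) > 0"
  shows "density_mat n (complex_of_real (1 / Re (mtrace X)) \<cdot>\<^sub>m X)"
proof -
  let ?t = "1 / Re (mtrace X)" and ?Y = "complex_of_real (1 / Re (mtrace X)) \<cdot>\<^sub>m X"
  have h: "hermitian_mat n X" using p by (simp add: psd_mat_def)
  note hX = hermitian_matD[OF h]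
  have "psd_mat n ?Y"
  proof (rule psd_matI)
    show "hermitian_mat n ?Y" by (rule hermitian_matI) (use hX in auto)
    fix f :: "nat \<Rightarrow> complex"
    have "(\<Sum>i<n. \<Sum>j<n. cnj (f i) * ?Y $$ (i, j) * f j)
        = complex_of_real ?t * (\<Sum>i<n. \<Sum>j<n. cnj (f i) * X $$ (i, j) * f j)"
      unfolding sum_distrib_left using hX(1) by (intro sum.cong refl) auto
    hence "Re (\<Sum>i<n. \<Sum>j<n. cnj (f i) * ?Y $$ (i, j) * f j)
        = ?t * Re (\<Sum>i<n. \<Sum>j<n. cnj (f i) * X $$ (i, j) * f j)"
      by (simp only: Re_complex_of_real times_complex.sel Im_complex_of_real mult_zero_left diff_zero)
    thus "0 \<le> Re (\<Sum>i<n. \<Sum>j<n. cnj (f i) * ?Y $$ (i, j) * f j)"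
      using psd_matD[OF p, of f] t by simp
  qed
  moreover have "mtrace ?Y = complex_of_real ?t * mtrace X"
    using hX(1) by (auto simp: mtrace_def sum_distrib_left)
  moreover have "complex_of_real ?t * mtrace X = 1"
    using t by (subst psd_mat_trace(1)[OF p]) (simp flip: of_real_mult)
  ultimately show ?thesis unfolding density_mat_def by metis
qed

text \<open>The probabilities are the traces of the conditional operators, and the states on B are
  their normalisations.\<close>

lemma meas_A_cq_state:
  assumes u: "onb_vecs dA u" and r: "density_mat (dA * dB) \<rho>"
  shows "cq_state dA dB (meas_A dA dB u \<rho>)"
proof -
  have p: "psd_mat (dA * dB) \<rho>" and tr: "mtrace \<rho> = 1" using r by (auto simp: density_mat_def)
  have rc: "\<rho> \<in> carrier_mat (dA * dB) (dA * dB)" using p by (simp add: psd_mat_def hermitian_mat_def)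
  let ?X = "cond_mat dA dB u \<rho>"
  define pr where "pr l = Re (mtrace (?X l))" for l
  have pX: "psd_mat dB (?X l)" for l by (rule cond_mat_psd[OF p])
  have pr0: "0 \<le> pr l" for l unfolding pr_def by (rule psd_mat_trace(2)[OF pX])
  have "Re (\<Sum>l<dA. mtrace (?X l)) = 1" using sum_mtrace_cond_mat[OF u rc] tr by simp
  hence prs: "(\<Sum>l<dA. pr l) = 1" by (simp add: pr_def)
  then obtain l0 where l0: "pr l0 \<noteq> 0" by (metis sum.neutral zero_neq_one)
  \<comment> \<open>An outcome of probability zero has no normalised state; it borrows the one of
    \<open>l0\<close>, which its zero weight removes again.\<close>
  define ch where "ch l = (let k = if pr l = 0 then l0 else l in complex_of_real (1 / pr k) \<cdot>\<^sub>m ?X k)" for l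
  have ch: "density_mat dB (ch l)" for l
    using density_mat_normalize[OF pX] pr0 l0 by (auto simp: ch_def Let_def pr_def order.strict_iff_order)
  have chc: "ch l \<in> carrier_mat dB dB" for l
    using ch[of l] by (simp add: density_mat_def psd_mat_def hermitian_mat_def)
  \<comment> \<open>At weight zero the conditional operator itself is zero, being positive with
    trace zero.\<close>
  have prch: "complex_of_real (pr l) * ch l $$ (b, b') = ?X l $$ (b, b')" if "b < dB" "b' < dB" for l b b'
  proof (cases "pr l = 0")
    case True
    thus ?thesis using psd_mat_trace_zero[OF pX, of l b b'] that by (simp add: pr_def)
  next
    case False
    thus ?thesis using that by (simp add: ch_def cond_mat_def)
  qed
  have "meas_A dA dB u \<rho> = mat (dA * dB) (dA * dB) (\<lambda>(i, j).
      \<Sum>k<dA. (complex_of_real (pr k) \<cdot>\<^sub>m kron (proj (u k)) (ch k)) $$ (i, j))"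
  proof (rule eq_mat_pair_index[of _ dA dB dA dB])
    fix a b a' b' assume a: "a < dA" "b < dB" "a' < dA" "b' < dB"
    have "(complex_of_real (pr k) \<cdot>\<^sub>m kron (proj (u k)) (ch k)) $$ (a * dB + b, a' * dB + b')
        = u k $ a * cnj (u k $ a') * ?X k $$ (b, b')" if "k < dA" for k
    proof -
      have uk: "u k \<in> carrier_vec dA" using u that by (simp add: onb_vecs_def)
      hence pc: "proj (u k) \<in> carrier_mat dA dA" by (auto simp: proj_def)
      have "(complex_of_real (pr k) \<cdot>\<^sub>m kron (proj (u k)) (ch k)) $$ (a * dB + b, a' * dB + b')
          = complex_of_real (pr k) * kron (proj (u k)) (ch k) $$ (a * dB + b, a' * dB + b')"
        using kron_carrier[OF pc chc[of k]] a by (intro index_smult_mat) (auto simp: pair_index_less)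
      also have "\<dots> = u k $ a * cnj (u k $ a') * (complex_of_real (pr k) * ch k $$ (b, b'))"
        using a uk by (subst kron_index[OF pc chc]) (auto simp: proj_def)
      finally show ?thesis using prch[OF a(2,4)] by simp
    qed
    thus "meas_A dA dB u \<rho> $$ (a * dB + b, a' * dB + b')
      = mat (dA * dB) (dA * dB) (\<lambda>(i, j).
          \<Sum>k<dA. (complex_of_real (pr k) \<cdot>\<^sub>m kron (proj (u k)) (ch k)) $$ (i, j)) $$ (a * dB + b, a' * dB + b')"
      using a by (simp add: meas_A_index[OF u rc] pair_index_less)
  qed auto
  thus ?thesis unfolding cq_state_def using u pr0 prs ch by blast
qed

text \<open>A classical-quantum state with basis \<open>u\<close> realigns into the range of
  \<open>meas_mat dA u\<close>, which makes it comparable with the projection of another realigned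
  state onto that range. The rows of \<open>T\<close> are the weighted vectorised states on
  B.\<close>

lemma realign_cq_state:
  assumes "cq_state dA dB \<chi>"
  obtains u T where "onb_vecs dA u" "\<chi> \<in> carrier_mat (dA * dB) (dA * dB)"
    "T \<in> carrier_mat dA (dB * dB)" "realign dA dB \<chi> = meas_mat dA u * T"
proof -
  obtain u pr ch where u: "onb_vecs dA u" and ch: "\<forall>k<dA. density_mat dB (ch k)"
    and chi: "\<chi> = mat (dA * dB) (dA * dB) (\<lambda>(i, j).
        \<Sum>k<dA. (complex_of_real (pr k) \<cdot>\<^sub>m kron (proj (u k)) (ch k)) $$ (i, j))"
    using assms unfolding cq_state_def by blast
  define T where "T = mat dA (dB * dB) (\<lambda>(k, j). complex_of_real (pr k) * ch k $$ (j div dB, j mod dB))"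
  have Tc: "T \<in> carrier_mat dA (dB * dB)" by (simp add: T_def)
  have "realign dA dB \<chi> = meas_mat dA u * T"
  proof (rule eq_mat_pair_index[of _ dA dA dB dB])
    show "meas_mat dA u * T \<in> carrier_mat (dA * dA) (dB * dB)"
      using meas_mat_carrier Tc by (rule mult_carrier_mat)
    fix a a' b b' assume a: "a < dA" "a' < dA" "b < dB" "b' < dB"
    have "(complex_of_real (pr k) \<cdot>\<^sub>m kron (proj (u k)) (ch k)) $$ (a * dB + b, a' * dB + b')
        = meas_mat dA u $$ (a * dA + a', k) * T $$ (k, b * dB + b')" if "k < dA" for k
    proof -
      have uk: "u k \<in> carrier_vec dA" using u that by (simp add: onb_vecs_def)
      hence pc: "proj (u k) \<in> carrier_mat dA dA" by (auto simp: proj_def)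
      have chc: "ch k \<in> carrier_mat dB dB"
        using ch that by (simp add: density_mat_def psd_mat_def hermitian_mat_def)
      have "(complex_of_real (pr k) \<cdot>\<^sub>m kron (proj (u k)) (ch k)) $$ (a * dB + b, a' * dB + b')
          = complex_of_real (pr k) * kron (proj (u k)) (ch k) $$ (a * dB + b, a' * dB + b')"
        using kron_carrier[OF pc chc] a by (intro index_smult_mat) (auto simp: pair_index_less)
      also have "\<dots> = u k $ a * cnj (u k $ a') * (complex_of_real (pr k) * ch k $$ (b, b'))"
        using a uk by (subst kron_index[OF pc chc]) (auto simp: proj_def)
      finally show ?thesis
        using a that pair_index_less[OF a(3,4)] by (simp add: meas_mat_index T_def)
    qed
    thus "realign dA dB \<chi> $$ (a * dA + a', b * dB + b') = (meas_mat dA u * T) $$ (a * dA + a', b * dB + b')"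
      using a by (subst mult_mat_index[OF meas_mat_carrier Tc])
        (auto simp: realign_index chi pair_index_less)
  qed simp
  thus ?thesis using that u Tc chi by auto
qed

section \<open>Orthogonal projection onto the range of an isometry\<close>

lemma isometry_projection:
  assumes Q: "Q \<in> carrier_mat m k" "mat_adjoint Q * Q = 1\<^sub>m k" and R: "R \<in> carrier_mat m n"
  defines "PR \<equiv> Q * (mat_adjoint Q * R)"
  shows frob_sq_projection: "frob_sq R = frob_sq (R - PR) + frob_sq PR"
    and frob_sq_projection_closest: "T \<in> carrier_mat k n \<Longrightarrow> frob_sq (R - PR) \<le> frob_sq (R - Q * T)"
proof -
  have Q': "mat_adjoint Q \<in> carrier_mat k m" using Q by simp
  have QR: "mat_adjoint Q * R \<in> carrier_mat k n" using Q' R by simp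
  have PR: "PR \<in> carrier_mat m n" using Q QR by (simp add: PR_def)
  have "mat_adjoint Q * PR = mat_adjoint Q * Q * (mat_adjoint Q * R)"
    unfolding PR_def by (rule assoc_mult_mat[OF Q' Q(1) QR, symmetric])
  also have "\<dots> = mat_adjoint Q * R" unfolding Q(2) by (rule left_mult_one_mat[OF QR])
  \<comment> \<open>The residual is orthogonal to the range of \<open>Q\<close>; both claims are
    then instances of Pythagoras.\<close>
  finally have orth: "mat_adjoint Q * (R - PR) = 0\<^sub>m k n"
    using QR by (simp add: mult_minus_distrib_mat[OF Q' R PR] minus_r_inv_mat[OF QR])
  have RP: "R - PR \<in> carrier_mat m n" by (rule minus_carrier_mat[OF PR])
  have "R - PR + PR = R" using R PR by (intro eq_matI) auto
  thus "frob_sq R = frob_sq (R - PR) + frob_sq PR"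
    using frob_sq_pythagoras[OF Q(1) RP QR orth] by (simp add: PR_def)
  assume T: "T \<in> carrier_mat k n"
  have QT: "Q * T \<in> carrier_mat m n" using Q T by simp
  have "Q * (mat_adjoint Q * R - T) = PR - Q * T"
    unfolding PR_def by (rule mult_minus_distrib_mat[OF Q(1) QR T])
  moreover have "R - PR + (PR - Q * T) = R - Q * T"
    using R PR Q(1) T by (intro eq_matI) auto
  moreover have "mat_adjoint Q * R - T \<in> carrier_mat k n" by (rule minus_carrier_mat[OF T])
  ultimately have "frob_sq (R - Q * T) = frob_sq (R - PR) + frob_sq (PR - Q * T)"
    using frob_sq_pythagoras[OF Q(1) RP _ orth] by metis
  thus "frob_sq (R - PR) \<le> frob_sq (R - Q * T)" using frob_sq_nonneg[of "PR - Q * T"] by simp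
qed

text \<open>\<open>Q * mat_adjoint Q\<close> is self-adjoint and does not increase norms, so the
  min--max bound applies.\<close>

lemma gram_eigs_projection_le:
  assumes Q: "Q \<in> carrier_mat m k" "mat_adjoint Q * Q = 1\<^sub>m k" and R: "R \<in> carrier_mat m n" and i: "i < m"
  shows "gram_eigs (Q * (mat_adjoint Q * R)) ! i \<le> gram_eigs R ! i"
proof -
  have Q': "mat_adjoint Q \<in> carrier_mat k m" using Q by simp
  have "gram_eigs (Q * mat_adjoint Q * R) ! i \<le> gram_eigs R ! i"
  proof (rule gram_eigs_contraction_le[OF R _ _ i])
    show "Q * mat_adjoint Q \<in> carrier_mat m m" using Q(1) Q' by simp
    fix v :: "complex mat" assume v: "v \<in> carrier_mat m 1"
    have "mat_adjoint (Q * mat_adjoint Q) * v = Q * (mat_adjoint Q * v)"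
      using assoc_mult_mat[OF Q(1) Q' v] by (simp add: mat_adjoint_mult[OF Q(1) Q'])
    thus "frob_sq (mat_adjoint (Q * mat_adjoint Q) * v) \<le> frob_sq v"
      using frob_sq_projection[OF Q v] frob_sq_nonneg[of "v - Q * (mat_adjoint Q * v)"] by simp
  qed
  thus ?thesis by (simp add: assoc_mult_mat[OF Q(1) Q' R])
qed

subsection \<open>Elementary symmetric functions of powers\<close>

definition esym :: "nat \<Rightarrow> real \<Rightarrow> nat \<Rightarrow> (nat \<Rightarrow> real) \<Rightarrow> real" where
  "esym h p n s = (\<Sum>R \<in> {R. R \<subseteq> {0..<n} \<and> card R = h}. \<Prod>k\<in>R. s k powr p)"

lemma finite_subsets_card: "finite {R. R \<subseteq> {0..<n::nat} \<and> card R = h}"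
  by (rule finite_subset[of _ "Pow {0..<n}"]) auto

lemma esym_nonneg: "0 \<le> esym h p n s"
  unfolding esym_def by (intro sum_nonneg prod_nonneg) auto

lemma prod_powr_mono:
  assumes p: "1 \<le> p" and R: "R \<subseteq> {0..<n}" and xy: "\<And>k. k < n \<Longrightarrow> 0 \<le> y k \<and> y k \<le> x k"
  shows "(\<Prod>k\<in>R. y k powr p) \<le> (\<Prod>k\<in>R. x k powr (p::real))"
  using p R xy by (intro prod_mono conjI powr_mono2) auto

lemma esym_mono:
  assumes "1 \<le> p" "\<And>k. k < n \<Longrightarrow> 0 \<le> y k \<and> y k \<le> x k"
  shows "esym h p n y \<le> esym h p n x"
  unfolding esym_def using assms by (intro sum_mono prod_powr_mono[of _ _ n]) auto

lemma esym_1: "esym 1 p n s = (\<Sum>k<n. s k powr p)"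
proof -
  have "{R. R \<subseteq> {0..<n} \<and> card R = 1} = (\<lambda>k. {k}) ` {..<n}"
    by (auto simp: card_1_singleton_iff)
  thus ?thesis by (simp add: esym_def sum.reindex)
qed

lemma esym_tendsto:
  assumes p: "1 \<le> p" and Y: "\<And>k. k < n \<Longrightarrow> (\<lambda>m. Y m k) \<longlonglongrightarrow> x k" "\<And>m k. k < n \<Longrightarrow> 0 \<le> Y m k"
  shows "(\<lambda>m. esym h p n (Y m)) \<longlonglongrightarrow> esym h p n x"
  unfolding esym_def using p Y by (intro tendsto_sum tendsto_prod tendsto_powr' tendsto_const) auto

text \<open>Every term can only drop when \<open>x\<close> is replaced by \<open>Y m\<close>, so the
  total deficit bounds the deficit of the term for \<open>R\<close>, hence \<open>c\<close> times
  that of \<open>x k powr p\<close>, where \<open>c\<close> is the positive product of the other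
  factors at \<open>x\<close>.\<close>

lemma esym_tendsto_converse:
  assumes p: "1 \<le> p" and lim: "(\<lambda>m. esym h p n (Y m)) \<longlonglongrightarrow> esym h p n x"
    and Y: "\<And>m k. k < n \<Longrightarrow> 0 \<le> Y m k \<and> Y m k \<le> x k"
    and R: "R \<subseteq> {0..<n}" "card R = h" "k \<in> R" "\<And>j. j \<in> R - {k} \<Longrightarrow> 0 < x j"
  shows "(\<lambda>m. Y m k) \<longlonglongrightarrow> x k"
proof -
  have fR: "finite R" using R(1) finite_subset by blast
  have k: "k < n" using R by auto
  define c where "c = (\<Prod>j\<in>R - {k}. x j powr p)"
  have c: "0 < c" unfolding c_def using R(4) by (intro prod_pos) force
  have low: "x k powr p - (esym h p n x - esym h p n (Y m)) / c \<le> Y m k powr p" for m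
  proof -
    have "c * (x k powr p - Y m k powr p) \<le> (\<Prod>j\<in>R. x j powr p) - (\<Prod>j\<in>R. Y m j powr p)"
    proof -
      have "(\<Prod>j\<in>R - {k}. Y m j powr p) \<le> c"
        unfolding c_def using p R Y by (intro prod_powr_mono[of _ _ n]) auto
      hence "Y m k powr p * (\<Prod>j\<in>R - {k}. Y m j powr p) \<le> Y m k powr p * c"
        by (intro mult_left_mono) auto
      thus ?thesis
        unfolding prod.remove[OF fR R(3)] c_def[symmetric] by (simp add: algebra_simps)
    qed
    also have "\<dots> \<le> (\<Sum>R \<in> {R. R \<subseteq> {0..<n} \<and> card R = h}. (\<Prod>j\<in>R. x j powr p) - (\<Prod>j\<in>R. Y m j powr p))"
    proof (rule member_le_sum)
      show "0 \<le> (\<Prod>j\<in>S. x j powr p) - (\<Prod>j\<in>S. Y m j powr p)"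
        if "S \<in> {R. R \<subseteq> {0..<n} \<and> card R = h} - {R}" for S
        using prod_powr_mono[OF p, of S n "Y m" x] that Y by auto
    qed (use R finite_subsets_card in auto)
    also have "\<dots> = esym h p n x - esym h p n (Y m)"
      by (simp add: esym_def sum_subtractf)
    finally show ?thesis using c by (simp add: field_simps)
  qed
  have "(\<lambda>m. x k powr p - (esym h p n x - esym h p n (Y m)) / c) \<longlonglongrightarrow> x k powr p - (esym h p n x - esym h p n x) / c"
    by (intro tendsto_intros lim) (use c in auto)
  hence l1: "(\<lambda>m. x k powr p - (esym h p n x - esym h p n (Y m)) / c) \<longlonglongrightarrow> x k powr p" by simp
  have "(\<lambda>m. Y m k powr p) \<longlonglongrightarrow> x k powr p"
  proof (rule tendsto_sandwich[OF _ _ l1 tendsto_const])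
    show "\<forall>\<^sub>F m in sequentially. x k powr p - (esym h p n x - esym h p n (Y m)) / c \<le> Y m k powr p"
      using low by simp
    show "\<forall>\<^sub>F m in sequentially. Y m k powr p \<le> x k powr p"
      using Y[OF k] p by (intro always_eventually allI powr_mono2) auto
  qed
  hence "(\<lambda>m. (Y m k powr p) powr (1 / p)) \<longlonglongrightarrow> (x k powr p) powr (1 / p)"
    by (rule tendsto_powr'[OF _ tendsto_const]) (use p in auto)
  moreover have "0 \<le> x k" using Y[OF k] by (meson order_trans)
  ultimately show ?thesis using p Y[OF k] by (simp add: powr_powr)
qed

text \<open>Equality with the upper bound is expressed by an approximating sequence, so it does not
  presuppose that the supremum is attained.\<close>

lemma Sup_eq_upper_bound_iff_seq:
  fixes E :: "'a \<Rightarrow> real"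
  assumes ne: "\<exists>u. P u" and le: "\<And>u. P u \<Longrightarrow> E u \<le> M"
  shows "Sup {E u |u. P u} \<le> M"
    and "M - Sup {E u |u. P u} = 0 \<longleftrightarrow> (\<exists>U. (\<forall>m. P (U m)) \<and> (\<lambda>m::nat. E (U m)) \<longlonglongrightarrow> M)"
proof -
  have ne': "{E u |u. P u} \<noteq> {}" using ne by auto
  have bdd: "bdd_above {E u |u. P u}" using le by (auto simp: bdd_above_def)
  show S: "Sup {E u |u. P u} \<le> M" using ne' le by (intro cSup_least) auto
  show "M - Sup {E u |u. P u} = 0 \<longleftrightarrow> (\<exists>U. (\<forall>m. P (U m)) \<and> (\<lambda>m::nat. E (U m)) \<longlonglongrightarrow> M)"
  proof
    assume eq: "M - Sup {E u |u. P u} = 0"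
    have "\<exists>u. P u \<and> M - inverse (real (Suc m)) < E u" for m
    proof -
      have "M - inverse (real (Suc m)) < Sup {E u |u. P u}" using eq by simp
      thus ?thesis using less_cSup_iff[OF ne' bdd] by auto
    qed
    then obtain U where U: "\<And>m. P (U m)" "\<And>m. M - inverse (real (Suc m)) < E (U m)" by metis
    have "(\<lambda>m. M - inverse (real (Suc m))) \<longlonglongrightarrow> M - 0"
      by (intro tendsto_intros LIMSEQ_inverse_real_of_nat)
    hence "(\<lambda>m. E (U m)) \<longlonglongrightarrow> M"
      using tendsto_sandwich[of "\<lambda>m. M - inverse (real (Suc m))" "\<lambda>m. E (U m)" sequentially "\<lambda>_. M" M]
        U less_imp_le[OF U(2)] le by simp
    thus "\<exists>U. (\<forall>m. P (U m)) \<and> (\<lambda>m::nat. E (U m)) \<longlonglongrightarrow> M" using U by blast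
  next
    assume "\<exists>U. (\<forall>m. P (U m)) \<and> (\<lambda>m::nat. E (U m)) \<longlonglongrightarrow> M"
    then obtain U where U: "\<And>m. P (U m)" "(\<lambda>m::nat. E (U m)) \<longlonglongrightarrow> M" by blast
    have "M \<le> Sup {E u |u. P u}"
      by (rule LIMSEQ_le_const2[OF U(2)]) (use U bdd in \<open>auto intro!: cSup_upper\<close>)
    thus "M - Sup {E u |u. P u} = 0" using S by simp
  qed
qed

lemma Inf_eq_zero_iff_seq:
  fixes E :: "'a \<Rightarrow> real"
  assumes ne: "\<exists>u. P u" and ge: "\<And>u. P u \<Longrightarrow> 0 \<le> E u"
  shows "Inf {E u |u. P u} = 0 \<longleftrightarrow> (\<exists>U. (\<forall>m. P (U m)) \<and> (\<lambda>m::nat. E (U m)) \<longlonglongrightarrow> 0)"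
proof -
  have "uminus ` {E u |u. P u} = {- E u |u. P u}" by auto
  hence "Inf {E u |u. P u} = - Sup {- E u |u. P u}" by (simp add: Inf_real_def)
  thus ?thesis
    using Sup_eq_upper_bound_iff_seq(2)[of P "\<lambda>u. - E u" 0, OF ne] ge
      tendsto_minus_cancel_left[of "\<lambda>m. E (_ m)" 0 sequentially] by simp
qed

subsection \<open>Discord\<close>

definition sval :: "nat \<Rightarrow> nat \<Rightarrow> complex mat \<Rightarrow> nat \<Rightarrow> real" where
  "sval dA dB \<sigma> k = sqrt (gram_eigs (realign dA dB \<sigma>) ! k)"

text \<open>The inner sum is nonnegative, so the outer power \<open>p\<close> undoes the root
  \<open>1/p\<close>.\<close>

lemma CMN_powr:
  assumes "herm_onb dA A" "herm_onb dB B" "hermitian_mat (dA * dB) \<sigma>" and p: "1 \<le> p"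
  shows "(CMN dA dB A B h p \<sigma>) powr p = esym h p ((min dA dB)\<^sup>2) (sval dA dB \<sigma>)"
proof -
  let ?s = "sing_vals (corr_mat dA dB A B \<sigma>)"
  have d: "(min dA dB)\<^sup>2 \<le> dA * dA" by (auto simp: power2_eq_square intro!: mult_le_mono)
  have len: "length ?s = (min dA dB)\<^sup>2"
    using d length_gram_eigs[OF realign_carrier, of dA dB \<sigma>] by (simp add: sing_vals_corr_mat[OF assms(1-3)])
  have nth: "?s ! k = sval dA dB \<sigma> k" if "k < (min dA dB)\<^sup>2" for k
    using that d length_gram_eigs[OF realign_carrier, of dA dB \<sigma>]
    by (simp add: sing_vals_corr_mat[OF assms(1-3)] sval_def)
  have "(\<Sum>R \<in> {R. R \<subseteq> {0..<length ?s} \<and> card R = h}. \<Prod>k\<in>R. (?s ! k) powr p)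
      = esym h p ((min dA dB)\<^sup>2) (sval dA dB \<sigma>)"
    unfolding esym_def len by (intro sum.cong prod.cong refl) (auto simp: nth subset_iff)
  thus ?thesis
    using p esym_nonneg[of h p "(min dA dB)\<^sup>2" "sval dA dB \<sigma>"]
    by (simp add: CMN_def minor_norm_def Let_def powr_powr)
qed

lemma sval_meas_A_le:
  assumes u: "onb_vecs dA u" and r: "\<rho> \<in> carrier_mat (dA * dB) (dA * dB)" and k: "k < (min dA dB)\<^sup>2"
  shows "0 \<le> sval dA dB (meas_A dA dB u \<rho>) k \<and> sval dA dB (meas_A dA dB u \<rho>) k \<le> sval dA dB \<rho> k"
proof -
  have "(min dA dB)\<^sup>2 \<le> dA * dA" by (auto simp: power2_eq_square intro!: mult_le_mono)
  hence k': "k < dA * dA" using k by simp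
  show ?thesis
    using gram_eigs_nonneg[OF realign_carrier[of dA dB "meas_A dA dB u \<rho>"] k']
      gram_eigs_projection_le[OF meas_mat_carrier meas_mat_isometry[OF u] realign_carrier k']
    by (simp add: sval_def realign_meas_A[OF u r])
qed

text \<open>The squares are the eigenvalues of the Gram matrix, whose total is the squared norm;
  cutting the list at \<open>(min dA dB)\<^sup>2\<close> loses only zeros.\<close>

lemma esym_sval_frob_sq:
  "esym 1 2 ((min dA dB)\<^sup>2) (sval dA dB \<sigma>) = frob_sq (realign dA dB \<sigma>)"
proof -
  let ?g = "gram_eigs (realign dA dB \<sigma>)"
  have d: "(min dA dB)\<^sup>2 \<le> dA * dA" by (auto simp: power2_eq_square intro!: mult_le_mono)
  have "esym 1 2 ((min dA dB)\<^sup>2) (sval dA dB \<sigma>) = (\<Sum>k<(min dA dB)\<^sup>2. ?g ! k)"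
    unfolding esym_1
  proof (intro sum.cong refl)
    fix k assume "k \<in> {..<(min dA dB)\<^sup>2}"
    hence "0 \<le> ?g ! k" using d by (intro gram_eigs_nonneg[OF realign_carrier]) auto
    thus "sval dA dB \<sigma> k powr 2 = ?g ! k" by (simp add: sval_def)
  qed
  also have "\<dots> = (\<Sum>k<dA * dA. ?g ! k)"
  proof (rule sum.mono_neutral_left)
    show "\<forall>k\<in>{..<dA * dA} - {..<(min dA dB)\<^sup>2}. ?g ! k = 0"
    proof
      fix k assume k: "k \<in> {..<dA * dA} - {..<(min dA dB)\<^sup>2}"
      \<comment> \<open>The omitted range is nonempty only for \<open>dB < dA\<close>, where the cut
        is at the number of columns.\<close>
      hence "dB * dB \<le> k" by (auto simp: min_def power2_eq_square split: if_splits)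
      thus "?g ! k = 0" using k by (intro gram_eigs_zero_beyond_cols[OF realign_carrier]) auto
    qed
  qed (use d in auto)
  also have "\<dots> = frob_sq (realign dA dB \<sigma>)" by (rule sum_gram_eigs[OF realign_carrier])
  finally show ?thesis .
qed

text \<open>Realignment turns the measurement into an orthogonal projection, so the squared distance
  is a Pythagorean difference of squared norms.\<close>

lemma frob_sq_meas_A:
  assumes u: "onb_vecs dA u" and r: "\<rho> \<in> carrier_mat (dA * dB) (dA * dB)"
  shows "frob_sq (\<rho> - meas_A dA dB u \<rho>)
    = esym 1 2 ((min dA dB)\<^sup>2) (sval dA dB \<rho>) - esym 1 2 ((min dA dB)\<^sup>2) (sval dA dB (meas_A dA dB u \<rho>))"
  using frob_sq_projection[OF meas_mat_carrier meas_mat_isometry[OF u] realign_carrier, of dB \<rho>]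
    frob_sq_realign[of "\<rho> - meas_A dA dB u \<rho>" dA dB] r
  unfolding esym_sval_frob_sq realign_meas_A[OF u r, symmetric]
  by (simp add: realign_minus minus_carrier_mat)

lemma ex_onb_vecs: "\<exists>u. onb_vecs n u"
  using onb_vecs_col_unitary[of n "1\<^sub>m n"] by (auto simp: unitary_mat_def)

text \<open>Any classical-quantum state may be replaced by the measured state with the same basis,
  which is itself classical-quantum and at most as far from \<open>\<rho>\<close>.\<close>

lemma geo_discord_zero_iff:
  assumes r: "density_mat (dA * dB) \<rho>"
  shows "geo_discord dA dB \<rho> = 0 \<longleftrightarrow>
    (\<exists>U. (\<forall>m. onb_vecs dA (U m)) \<and> (\<lambda>m::nat. frob_sq (\<rho> - meas_A dA dB (U m) \<rho>)) \<longlonglongrightarrow> 0)"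
proof -
  have rc: "\<rho> \<in> carrier_mat (dA * dB) (dA * dB)"
    using r by (simp add: density_mat_def psd_mat_def hermitian_mat_def)
  have ne: "\<exists>\<chi>. cq_state dA dB \<chi>" using meas_A_cq_state[OF _ r] ex_onb_vecs by blast
  have "geo_discord dA dB \<rho> = 0 \<longleftrightarrow>
      (\<exists>X. (\<forall>m. cq_state dA dB (X m)) \<and> (\<lambda>m::nat. frob_sq (\<rho> - X m)) \<longlonglongrightarrow> 0)"
    unfolding geo_discord_def by (rule Inf_eq_zero_iff_seq[OF ne frob_sq_nonneg])
  also have "\<dots> \<longleftrightarrow>
      (\<exists>U. (\<forall>m. onb_vecs dA (U m)) \<and> (\<lambda>m::nat. frob_sq (\<rho> - meas_A dA dB (U m) \<rho>)) \<longlonglongrightarrow> 0)"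
  proof
    assume "\<exists>X. (\<forall>m. cq_state dA dB (X m)) \<and> (\<lambda>m::nat. frob_sq (\<rho> - X m)) \<longlonglongrightarrow> 0"
    then obtain X where X: "\<And>m. cq_state dA dB (X m)" "(\<lambda>m::nat. frob_sq (\<rho> - X m)) \<longlonglongrightarrow> 0" by blast
    have "\<exists>u. onb_vecs dA u \<and> frob_sq (\<rho> - meas_A dA dB u \<rho>) \<le> frob_sq (\<rho> - X m)" for m
    proof -
      obtain u T where u: "onb_vecs dA u" and Xc: "X m \<in> carrier_mat (dA * dB) (dA * dB)"
        and T: "T \<in> carrier_mat dA (dB * dB)" "realign dA dB (X m) = meas_mat dA u * T"
        by (rule realign_cq_state[OF X(1)])
      have "frob_sq (realign dA dB \<rho> - realign dA dB (meas_A dA dB u \<rho>))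
          \<le> frob_sq (realign dA dB \<rho> - realign dA dB (X m))"
        unfolding T(2) realign_meas_A[OF u rc]
        by (rule frob_sq_projection_closest[OF meas_mat_carrier meas_mat_isometry[OF u] realign_carrier T(1)])
      thus ?thesis using u rc Xc
        by (auto simp: realign_minus[symmetric] frob_sq_realign minus_carrier_mat)
    qed
    then obtain U where U: "\<And>m. onb_vecs dA (U m)"
        "\<And>m. frob_sq (\<rho> - meas_A dA dB (U m) \<rho>) \<le> frob_sq (\<rho> - X m)" by metis
    have "(\<lambda>m::nat. frob_sq (\<rho> - meas_A dA dB (U m) \<rho>)) \<longlonglongrightarrow> 0"
      by (rule tendsto_sandwich[OF _ _ tendsto_const X(2)]) (auto simp: U frob_sq_nonneg)
    thus "\<exists>U. (\<forall>m. onb_vecs dA (U m)) \<and> (\<lambda>m::nat. frob_sq (\<rho> - meas_A dA dB (U m) \<rho>)) \<longlonglongrightarrow> 0"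
      using U by blast
  next
    assume "\<exists>U. (\<forall>m. onb_vecs dA (U m)) \<and> (\<lambda>m::nat. frob_sq (\<rho> - meas_A dA dB (U m) \<rho>)) \<longlonglongrightarrow> 0"
    then obtain U where U: "\<forall>m. onb_vecs dA (U m)"
      "(\<lambda>m::nat. frob_sq (\<rho> - meas_A dA dB (U m) \<rho>)) \<longlonglongrightarrow> 0" by blast
    thus "\<exists>X. (\<forall>m. cq_state dA dB (X m)) \<and> (\<lambda>m::nat. frob_sq (\<rho> - X m)) \<longlonglongrightarrow> 0"
      using meas_A_cq_state[OF _ r] by (intro exI[of _ "\<lambda>m. meas_A dA dB (U m) \<rho>"]) auto
  qed
  finally show ?thesis .
qed

text \<open>If the second singular value vanishes, \<open>\<rho>\<close> is a product operator, and the eigenbasis of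
  its \<open>A\<close>-marginal gives a measurement that does not disturb it.\<close>
lemma undisturbed_if_second_sval_zero:
  assumes r: "density_mat (dA * dB) \<rho>" and d: "2 \<le> (min dA dB)\<^sup>2" and z: "sval dA dB \<rho> 1 = 0"
  obtains u where "onb_vecs dA u" "meas_A dA dB u \<rho> = \<rho>"
proof -
  have h: "hermitian_mat (dA * dB) \<rho>" and tr: "mtrace \<rho> = 1"
    using r by (auto simp: density_mat_def psd_mat_def)
  note hr = hermitian_matD[OF h]
  let ?R = "realign dA dB \<rho>"
  have "(min dA dB)\<^sup>2 \<le> dA * dA" by (auto simp: power2_eq_square intro!: mult_le_mono)
  hence "1 < dA * dA" using d by simp
  moreover have "gram_eigs ?R ! 1 = 0" using z by (simp add: sval_def)
  ultimately obtain w y where wy: "\<And>i j. i < dA * dA \<Longrightarrow> j < dB * dB \<Longrightarrow> ?R $$ (i, j) = w i * y j"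
    using rank_one_if_second_gram_eig_zero[OF realign_carrier] by metis
  have prod: "\<rho> $$ (a * dB + b, a' * dB + b') = w (a * dA + a') * y (b * dB + b')"
    if "a < dA" "a' < dA" "b < dB" "b' < dB" for a a' b b'
    using wy[of "a * dA + a'" "b * dB + b'"] that by (simp add: realign_index pair_index_less)
  \<comment> \<open>\<open>t\<close> is the trace of the B factor; it is nonzero because it is a
    factor of the trace of \<open>\<rho>\<close>.\<close>
  define t where "t = (\<Sum>b<dB. y (b * dB + b))"
  have "mtrace \<rho> = (\<Sum>a<dA. w (a * dA + a)) * t"
    using hr(1) by (simp add: mtrace_def sum_pair_index prod t_def sum_product)
  hence t: "t \<noteq> 0" using tr by auto
  \<comment> \<open>The A marginal of \<open>\<rho>\<close>: it is Hermitian, whereas the factor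
    \<open>w\<close> is only fixed up to a complex scalar.\<close>
  define N where "N = mat dA dA (\<lambda>(a, a'). \<Sum>b<dB. \<rho> $$ (a * dB + b, a' * dB + b))"
  have Nc: "N \<in> carrier_mat dA dA" by (simp add: N_def)
  have Nw: "N $$ (a, a') = w (a * dA + a') * t" if "a < dA" "a' < dA" for a a'
    using that by (simp add: N_def prod t_def sum_distrib_left)
  have "hermitian_mat dA N"
    by (rule hermitian_matI) (auto simp: N_def hr(2) pair_index_less)
  hence "mat_adjoint N = N" by (simp add: hermitian_mat_def)
  from hermitian_spectral(3)[OF Nc this] obtain W l where W: "unitary_mat dA W"
    and WN: "mat_adjoint W * N * W = mat_diag dA l" by blast
  have Wc: "W \<in> carrier_mat dA dA" using W by (simp add: unitary_mat_def)
  have u: "onb_vecs dA (col W)" by (rule onb_vecs_col_unitary[OF W])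
  have "W * (mat_adjoint W * N * W) * mat_adjoint W = W * mat_adjoint W * N * (W * mat_adjoint W)"
    using Wc Nc by (simp add: assoc_mult_mat[of _ dA dA _ dA _ dA] mult_carrier_mat[of _ dA dA _ dA])
  also have "\<dots> = N" using unitary_mat_right[OF W] Nc by simp
  finally have N: "N = W * mat_diag dA l * mat_adjoint W" unfolding WN ..
  have Ns: "N $$ (a, a') = (\<Sum>k<dA. W $$ (a, k) * l k * cnj (W $$ (a', k)))" if "a < dA" "a' < dA" for a a'
  proof -
    have "W * mat_diag dA l = mat dA dA (\<lambda>(i, j). W $$ (i, j) * l j)"
      using Wc by (subst mat_diag_mult_right[of _ dA dA]) (auto simp: mult.commute)
    thus ?thesis
      using that Wc by (subst N, subst mult_mat_index[of _ dA dA _ dA]) auto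
  qed
  \<comment> \<open>Chosen so that \<open>?Q * T\<close> rebuilds the product form; the division by
    \<open>t\<close> undoes the scaling in \<open>N\<close>.\<close>
  define T where "T = mat dA (dB * dB) (\<lambda>(k, j). l k * y j / t)"
  let ?Q = "meas_mat dA (col W)"
  have Tc: "T \<in> carrier_mat dA (dB * dB)" by (simp add: T_def)
  have QT: "?R = ?Q * T"
  proof (rule eq_mat_pair_index[of _ dA dA dB dB])
    show "?Q * T \<in> carrier_mat (dA * dA) (dB * dB)" using meas_mat_carrier Tc by (rule mult_carrier_mat)
    fix a a' b b' assume a: "a < dA" "a' < dA" "b < dB" "b' < dB"
    note p = pair_index_less[OF a(1,2)] pair_index_less[OF a(3,4)]
    have "(?Q * T) $$ (a * dA + a', b * dB + b')
        = (\<Sum>k<dA. W $$ (a, k) * cnj (W $$ (a', k)) * (l k * y (b * dB + b') / t))"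
      using a p Wc by (subst mult_mat_index[OF meas_mat_carrier Tc]) (auto simp: meas_mat_index T_def)
    also have "\<dots> = (\<Sum>k<dA. W $$ (a, k) * l k * cnj (W $$ (a', k))) * (y (b * dB + b') / t)"
      unfolding sum_distrib_right by (intro sum.cong refl) (simp add: mult_ac)
    also have "\<dots> = ?R $$ (a * dA + a', b * dB + b')"
      using t a p by (simp add: Ns[OF a(1,2), symmetric] Nw wy)
    finally show "?R $$ (a * dA + a', b * dB + b') = (?Q * T) $$ (a * dA + a', b * dB + b')" by simp
  qed simp
  \<comment> \<open>\<open>?R\<close> lies in the range of the isometry \<open>?Q\<close>, so the
    projection fixes it.\<close>
  have "mat_adjoint ?Q * (?Q * T) = mat_adjoint ?Q * ?Q * T"
    by (rule assoc_mult_mat[OF mat_adjoint_carrier[OF meas_mat_carrier] meas_mat_carrier Tc, symmetric])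
  also have "\<dots> = T" using meas_mat_isometry[OF u] Tc by simp
  finally have "realign dA dB (meas_A dA dB (col W) \<rho>) = ?R"
    unfolding realign_meas_A[OF u hr(1)] using QT by simp
  hence "meas_A dA dB (col W) \<rho> = \<rho>" using realign_inj hr(1) by (metis meas_A_carrier)
  thus ?thesis using that u by blast
qed

theorem theorem5:
  fixes dA dB :: nat and A B :: "nat \<Rightarrow> complex mat" and \<rho> :: "complex mat"
  assumes "1 \<le> dA" and "1 \<le> dB"
    and "herm_onb dA A" and "herm_onb dB B"
    and "density_mat (dA * dB) \<rho>"
  shows "(\<forall>(h::nat) (p::real). 1 \<le> h \<and> h \<le> (min dA dB)^2 \<and> 1 \<le> p
            \<longrightarrow> 0 \<le> discord_hp dA dB A B h p \<rho>)
       \<and> (\<forall>(h::nat) (p::real). h \<in> {1, 2} \<and> h \<le> (min dA dB)^2 \<and> 1 \<le> p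
            \<longrightarrow> (discord_hp dA dB A B h p \<rho> = 0 \<longleftrightarrow> geo_discord dA dB \<rho> = 0))"
proof -
  have h: "hermitian_mat (dA * dB) \<rho>" using assms(5) by (simp add: density_mat_def psd_mat_def)
  note rc = hermitian_matD(1)[OF h]
  define n where "n = (min dA dB)\<^sup>2"
  define x where "x = sval dA dB \<rho>"
  define Y where "Y u = sval dA dB (meas_A dA dB u \<rho>)" for u
  have xY: "0 \<le> Y u k \<and> Y u k \<le> x k" if "onb_vecs dA u" "k < n" for u k
    using sval_meas_A_le[OF that(1) rc] that(2) by (simp add: x_def Y_def n_def)
  \<comment> \<open>In terms of \<open>esym\<close> the operator bases \<open>A\<close> and
    \<open>B\<close> no longer appear.\<close>
  have D: "discord_hp dA dB A B h p \<rho> = esym h p n x - Sup {esym h p n (Y u) |u. onb_vecs dA u}"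
    if p: "1 \<le> p" for h p
  proof -
    have "{(CMN dA dB A B h p (meas_A dA dB u \<rho>)) powr p |u. onb_vecs dA u} = {esym h p n (Y u) |u. onb_vecs dA u}"
      by (rule Collect_cong, rule iff_exI)
         (use CMN_powr[OF assms(3,4) meas_A_hermitian[OF _ h] p, of _ h] in \<open>auto simp: Y_def n_def\<close>)
    thus ?thesis unfolding discord_hp_def CMN_powr[OF assms(3,4) h p] by (simp add: x_def n_def)
  qed
  have le: "esym h p n (Y u) \<le> esym h p n x" if "1 \<le> p" "onb_vecs dA u" for h p u
    using that xY by (intro esym_mono) auto
  have sup: "Sup {esym h p n (Y u) |u. onb_vecs dA u} \<le> esym h p n x"
    "esym h p n x - Sup {esym h p n (Y u) |u. onb_vecs dA u} = 0 \<longleftrightarrow>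
      (\<exists>U. (\<forall>m. onb_vecs dA (U m)) \<and> (\<lambda>m::nat. esym h p n (Y (U m))) \<longlonglongrightarrow> esym h p n x)"
    if "1 \<le> p" for h p
    using le[OF that] by (intro Sup_eq_upper_bound_iff_seq ex_onb_vecs; blast)+
  \<comment> \<open>The geometric discord is the instance \<open>h = 1\<close>,
    \<open>p = 2\<close>; what remains is to compare the convergence of two symmetric functions
    along one sequence.\<close>
  have geo: "geo_discord dA dB \<rho> = 0 \<longleftrightarrow>
      (\<exists>U. (\<forall>m. onb_vecs dA (U m)) \<and> (\<lambda>m::nat. esym 1 2 n (Y (U m))) \<longlonglongrightarrow> esym 1 2 n x)"
  proof -
    have "(\<lambda>m::nat. frob_sq (\<rho> - meas_A dA dB (U m) \<rho>)) \<longlonglongrightarrow> 0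
        \<longleftrightarrow> (\<lambda>m. esym 1 2 n (Y (U m))) \<longlonglongrightarrow> esym 1 2 n x" if "\<forall>m. onb_vecs dA (U m)" for U
    proof -
      have "(\<lambda>m::nat. frob_sq (\<rho> - meas_A dA dB (U m) \<rho>)) = (\<lambda>m. esym 1 2 n x - esym 1 2 n (Y (U m)))"
        using that by (simp add: frob_sq_meas_A[OF _ rc] x_def Y_def n_def)
      thus ?thesis
        using LIM_zero_iff[of "\<lambda>m. esym 1 2 n (Y (U m))" "esym 1 2 n x" sequentially]
          tendsto_minus_cancel_left[of "\<lambda>m. esym 1 2 n (Y (U m)) - esym 1 2 n x" 0 sequentially] by simp
    qed
    thus ?thesis unfolding geo_discord_zero_iff[OF assms(5)] by metis
  qed
  have "0 \<le> discord_hp dA dB A B h p \<rho>" if "1 \<le> p" for h p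
    using sup(1)[OF that] D[OF that] by simp
  moreover have "discord_hp dA dB A B h p \<rho> = 0 \<longleftrightarrow> geo_discord dA dB \<rho> = 0"
    if hh: "h \<in> {1, 2}" "h \<le> n" and p: "1 \<le> p" for h p
  proof (cases "h = 2 \<and> x 1 = 0")
    \<comment> \<open>Here strict monotonicity can fail, but some measurement leaves
      \<open>\<rho>\<close> undisturbed, and the constant sequence serves for all \<open>h\<close>
      and \<open>p\<close>.\<close>
    case True
    then obtain u where u: "onb_vecs dA u" "meas_A dA dB u \<rho> = \<rho>"
      using undisturbed_if_second_sval_zero[OF assms(5)] hh(2) by (auto simp: n_def x_def)
    hence "Y u = x" by (simp add: Y_def x_def)
    hence "\<exists>U. (\<forall>m. onb_vecs dA (U m)) \<and> (\<lambda>m::nat. esym h p n (Y (U m))) \<longlonglongrightarrow> esym h p n x" for h p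
      using u(1) by (intro exI[of _ "\<lambda>_. u"]) auto
    thus ?thesis unfolding D[OF p] sup(2)[OF p] geo by simp
  next
    case False
    have "x 1 \<le> x 0" if "2 \<le> n"
    proof -
      have "n \<le> dA * dA" unfolding n_def by (auto simp: power2_eq_square intro!: mult_le_mono)
      hence "1 < dA * dA" using that by simp
      thus ?thesis unfolding x_def sval_def
        by (intro real_sqrt_le_mono gram_eigs_antimono[OF realign_carrier]) auto
    qed
    moreover have "0 \<le> x 1" if "2 \<le> n" using xY[of _ 1] ex_onb_vecs[of dA] that by (auto intro: order_trans)
    ultimately have x01: "0 < x 0" "0 < x 1" if "h = 2" using that False hh(2) by force+
    \<comment> \<open>Each \<open>k\<close> needs a term of the sum that contains it and whose other
      factors are positive.\<close>
    have "\<exists>R. R \<subseteq> {0..<n} \<and> card R = h \<and> k \<in> R \<and> (\<forall>j\<in>R - {k}. 0 < x j)" if k: "k < n" for k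
    proof (cases "h = 1")
      case True
      thus ?thesis using k by (intro exI[of _ "{k}"]) auto
    next
      case False
      \<comment> \<open>The partner index is 0, or 1 if \<open>k\<close> is 0 itself; both carry
        positive singular values.\<close>
      thus ?thesis using k hh x01 by (intro exI[of _ "{k, if k = 0 then 1 else 0}"]) auto
    qed
    note pick = this
    have pick1: "\<exists>R. R \<subseteq> {0..<n} \<and> card R = 1 \<and> k \<in> R \<and> (\<forall>j\<in>R - {k}. 0 < x j)" if "k < n" for k
      using that by (intro exI[of _ "{k}"]) auto
    have "(\<lambda>m::nat. esym h p n (Y (U m))) \<longlonglongrightarrow> esym h p n x
        \<longleftrightarrow> (\<lambda>m. esym 1 2 n (Y (U m))) \<longlonglongrightarrow> esym 1 2 n x" if U: "\<forall>m. onb_vecs dA (U m)" for U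
    proof -
      have Y0: "0 \<le> Y (U m) k \<and> Y (U m) k \<le> x k" if "k < n" for m k using xY U that by blast
      \<comment> \<open>The right-hand side is free of \<open>h'\<close> and \<open>p'\<close>;
        using this for \<open>(h, p)\<close> and for \<open>(1, 2)\<close> links the two
        discords.\<close>
      have "(\<lambda>m::nat. esym h' p' n (Y (U m))) \<longlonglongrightarrow> esym h' p' n x
          \<longleftrightarrow> (\<forall>k<n. (\<lambda>m. Y (U m) k) \<longlonglongrightarrow> x k)"
        if p': "1 \<le> p'" and pk: "\<And>k. k < n \<Longrightarrow> \<exists>R. R \<subseteq> {0..<n} \<and> card R = h' \<and> k \<in> R \<and> (\<forall>j\<in>R - {k}. 0 < x j)" for h' p'
      proof
        assume lim: "(\<lambda>m::nat. esym h' p' n (Y (U m))) \<longlonglongrightarrow> esym h' p' n x"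
        show "\<forall>k<n. (\<lambda>m. Y (U m) k) \<longlonglongrightarrow> x k"
        proof (intro allI impI)
          fix k assume "k < n"
          then obtain R where "R \<subseteq> {0..<n}" "card R = h'" "k \<in> R" "\<forall>j\<in>R - {k}. 0 < x j"
            using pk by blast
          thus "(\<lambda>m. Y (U m) k) \<longlonglongrightarrow> x k"
            using Y0 by (intro esym_tendsto_converse[OF p' lim]) auto
        qed
      next
        assume "\<forall>k<n. (\<lambda>m. Y (U m) k) \<longlonglongrightarrow> x k"
        thus "(\<lambda>m::nat. esym h' p' n (Y (U m))) \<longlonglongrightarrow> esym h' p' n x"
          using Y0 by (intro esym_tendsto[OF p']) auto
      qed
      from this[OF p pick] this[of 2, OF _ pick1] show ?thesis by simp
    qed
    thus ?thesis unfolding D[OF p] sup(2)[OF p] geo by metis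
  qed
  ultimately show ?thesis unfolding n_def by blast
qed

end
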